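(* Let $X=(X^0,\mathcal B,\mu,T)$ be a measure preserving system. Let $k$ be a natural number, $a_1,\dots,a_k\in\mathbb Z$, and $f_1,\dots,f_k\in L^\infty(\mu)$. Then the averages $$\frac1N\sum_{n=1}^N\prod_{j=1}^kf_j(T^{a_jn}x)$$ converge in $L^2(\mu)$ as $N\to\infty$.
   Context: A measure preserving system $X=(X^0,\mathcal B,\mu,T)$ consists of a probability space $(X^0,\mathcal B,\mu)$ and an invertible measure preserving transformation $T$. The system is not assumed ergodic. *)

theory Defs
  imports "HOL-Probability.Probability"
begin

text \<open>
  The underlying set of the system is \<^term>\<open>space M\<close>, and only the behaviour of \<^term>\<open>T\<close>
  on this set matters. Invertibility is understood in the category of measurable spaces:
  \<^term>\<open>T\<close> is a bijection of \<^term>\<open>space M\<close> with measurable inverse. Neither ergodicity nor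
  any regularity of the probability space is assumed.
\<close>

locale measure_preserving_system = prob_space M for M :: "'a measure" +
  fixes T :: "'a \<Rightarrow> 'a"
  assumes measurable_T: "T \<in> measurable M M"
    and bij_betw_T: "bij_betw T (space M) (space M)"
    and measurable_inv_T: "the_inv_into (space M) T \<in> measurable M M"
    and emeasure_vimage_T: "\<And>A. A \<in> sets M \<Longrightarrow> emeasure M (T -` A \<inter> space M) = emeasure M A"

definition int_iterate :: "'a measure \<Rightarrow> ('a \<Rightarrow> 'a) \<Rightarrow> int \<Rightarrow> 'a \<Rightarrow> 'a" where
  "int_iterate M T n =
     (if 0 \<le> n then T ^^ nat n else (the_inv_into (space M) T) ^^ nat (- n))"

text \<open>
  The spaces below consist of functions rather than of classes modulo a.e. equality.
\<close>

definition L_infinity :: "'a measure \<Rightarrow> ('a \<Rightarrow> complex) set" where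
  "L_infinity M = {f \<in> borel_measurable M. esssup M (\<lambda>x. ereal (norm (f x))) < \<infinity>}"

definition L2_space :: "'a measure \<Rightarrow> ('a \<Rightarrow> complex) set" where
  "L2_space M = {f \<in> borel_measurable M. integrable M (\<lambda>x. (norm (f x))\<^sup>2)}"

definition L2_norm :: "'a measure \<Rightarrow> ('a \<Rightarrow> complex) \<Rightarrow> real" where
  "L2_norm M f = sqrt (LINT x|M. (norm (f x))\<^sup>2)"

text \<open>
  Membership of all \<^term>\<open>g n\<close> in \<open>L2_space\<close> is part of the definition, so that the Bochner integral
  in \<open>L2_norm\<close> never takes its default value \<open>0\<close> for a non-integrable function.
\<close>

definition converges_in_L2 :: "'a measure \<Rightarrow> (nat \<Rightarrow> 'a \<Rightarrow> complex) \<Rightarrow> bool" where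
  "converges_in_L2 M g \<longleftrightarrow>
     (\<forall>n. g n \<in> L2_space M) \<and>
     (\<exists>F \<in> L2_space M. (\<lambda>n. L2_norm M (\<lambda>x. g n x - F x)) \<longlonglongrightarrow> 0)"

end

theory Submission
  imports Defs
begin

text \<open>
  The proof is by induction on the number of functions, and each step trades one function for a
  larger system. Write \<open>\<tau> f = f \<circ> T\<close>, and let \<open>A\<^sub>N(f\<^sub>0,\<dots>,f\<^sub>k)\<close> be the average over \<open>n\<close> of
  \<open>\<tau>\<^bsup>a\<^sub>0n\<^esup>f\<^sub>0 \<cdots> \<tau>\<^bsup>a\<^sub>kn\<^esup>f\<^sub>k\<close>. Fix all functions except the last one and let \<open>V\<close> be the
  linear space of those \<open>v\<close> for which \<open>A\<^sub>N(f\<^sub>0,\<dots>,f\<^bsub>k-1\<^esub>,v)\<close> is Cauchy in \<open>L\<^sup>2\<close>. Moving the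
  factors of an inner product around,
  \<open>\<langle>A\<^sub>N(f\<^sub>0,\<dots>,u), h\<rangle> = \<langle>u, \<sigma>\<^sub>N\<rangle>\<close> where \<open>\<sigma>\<^sub>N\<close> is the average over \<open>m\<close> of
  \<open>\<tau>\<^bsup>-a\<^sub>km\<^esup>h \<cdot> \<Prod>\<^sub>j \<tau>\<^bsup>(a\<^sub>j-a\<^sub>k)m\<^esup>f\<^sub>j\<close>. So a function \<open>u\<close> whose averages do not tend to \<open>0\<close> correlates
  with such dual averages \<open>\<sigma>\<^sub>N\<close> for arbitrarily large \<open>N\<close>.

  Dual averages with large \<open>N\<close> behave like elements of \<open>V\<close>: since \<open>\<tau>\<^bsup>a\<^sub>kl\<^esup>\<sigma>\<^sub>N\<close> is, up to translating
  the variable \<open>m\<close> by \<open>l\<close>, an average of \<open>\<tau>\<^bsup>-a\<^sub>km\<^esup>h \<cdot> \<Prod>\<^sub>j \<tau>\<^bsup>a\<^sub>jl\<^esup>\<tau>\<^bsup>(a\<^sub>j-a\<^sub>k)m\<^esup>f\<^sub>j\<close>, the average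
  \<open>A\<^sub>M(f\<^sub>0,\<dots>,f\<^bsub>k-1\<^esub>,\<sigma>\<^sub>N)\<close> is close to a mean over \<open>m\<close> of averages that involve only the
  functions \<open>f\<^sub>j \<cdot> \<tau>\<^bsup>(a\<^sub>j-a\<^sub>k)m\<^esup>f\<^sub>j\<close> with \<open>j < k\<close>, multiplied by bounded factors
  (\<open>last_avg_of_dual_avg\<close>). The induction hypothesis would apply to each \<open>m\<close>, but with a rate
  depending on \<open>m\<close>. It is therefore applied once, to the product of the system with the finite
  probability space \<open>{1..N}\<close> of all parameters \<open>m\<close>.

  Here \<open>N\<close> has to tend to infinity, so the induction runs over sequences of systems and of uniformly
  bounded functions on them, whose \<open>L\<^sup>2\<close> norms are compared in the limit along a free ultrafilter.
  In this setting a sequence of dual averages whose lengths tend to infinity lies exactly in \<open>V\<close>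
  (\<open>dual_avg_L2_Cauchy\<close>). Conversely, if the averages of \<open>u\<close> are not eventually small, a diagonal
  choice of lengths produces such a sequence that correlates with \<open>u\<close>
  (\<open>large_averages_correlate\<close>). Splitting the last function as \<open>f\<^sub>k = v + u\<close> with \<open>v \<in> V\<close> almost at
  minimal distance from \<open>f\<^sub>k\<close>, the remainder \<open>u\<close> is almost orthogonal to \<open>V\<close>, so its averages
  are eventually small, while those of \<open>v\<close> are Cauchy (\<open>norm_convergence_Suc\<close>). Almost minimal
  distance suffices because the \<open>L\<^sup>2\<close> norm of the dual averages is bounded in terms of that of
  \<open>u\<close>, however large the supremum of \<open>u\<close> may be.

  The induction concerns real bounded functions. A product of complex functions is expanded into
  real and imaginary parts, and the completeness of \<open>L\<^sup>2\<close> turns Cauchy into convergent.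
\<close>

section \<open>Limits along a free ultrafilter\<close>

definition free_ultrafilter :: "nat filter \<Rightarrow> bool" where
  "free_ultrafilter U \<longleftrightarrow> U \<noteq> bot \<and> U \<le> sequentially \<and>
     (\<forall>P. eventually P U \<or> eventually (\<lambda>i. \<not> P i) U)"

text \<open>
  Zorn's lemma in the lattice of filters, where a smaller filter is a finer one: a minimal proper
  filter below \<open>sequentially\<close> decides every predicate, since otherwise the predicate could be added to it.
\<close>

lemma free_ultrafilter_exists: "\<exists>U. free_ultrafilter U"
proof -
  define A where "A = {F :: nat filter. F \<noteq> bot \<and> F \<le> sequentially}"
  have po: "partial_order_on A (relation_of (\<ge>) A)"
    by (rule partial_order_on_relation_ofI) auto
  have "\<exists>u\<in>A. \<forall>a\<in>C. a \<ge> u" if C: "C \<in> Chains (relation_of (\<ge>) A)" for C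
  proof (cases "C = {}")
    case True
    have "sequentially \<in> A" by (simp add: A_def)
    then show ?thesis using True by blast
  next
    case False
    have sub: "F \<in> A" if "F \<in> C" for F
      using C that by (auto simp: Chains_def relation_of_def)
    have tot: "F \<le> G \<or> G \<le> F" if "F \<in> C" "G \<in> C" for F G
      using C that by (auto simp: Chains_def relation_of_def)
    have base: "\<exists>x\<in>C. x \<le> inf F G" if "F \<in> C" "G \<in> C" for F G
      using tot[OF that] that by (metis inf.orderE inf.order_iff inf_commute order_refl)
    have "Inf C \<noteq> bot"
      using eventually_Inf_base[OF False base, of "\<lambda>_. False"] sub
      by (auto simp: A_def trivial_limit_def)
    moreover have "Inf C \<le> sequentially"
    proof -
      obtain F where "F \<in> C" using False by blast
      then show ?thesis using Inf_lower[of F C] sub[of F] by (auto simp: A_def intro: order_trans)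
    qed
    ultimately show ?thesis
      by (intro bexI[of _ "Inf C"]) (auto simp: A_def Inf_lower)
  qed
  from predicate_Zorn[OF po this] obtain U where
    U: "U \<in> A" and min: "\<And>F. F \<in> A \<Longrightarrow> F \<le> U \<Longrightarrow> F = U"
    by blast
  have "eventually P U \<or> eventually (\<lambda>i. \<not> P i) U" for P
  proof (rule ccontr)
    assume neg: "\<not> ?thesis"
    define F where "F = inf U (principal {i. P i})"
    have "F \<noteq> bot"
      using neg by (simp add: F_def trivial_limit_def eventually_inf_principal)
    moreover have "F \<le> U" by (simp add: F_def)
    ultimately have "F = U" using U by (intro min) (auto simp: A_def)
    moreover have "eventually P F" by (simp add: F_def eventually_inf_principal)
    ultimately show False using neg by simp
  qed
  then show ?thesis using U by (auto simp: A_def free_ultrafilter_def)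
qed

locale ultrafilter =
  fixes U :: "nat filter"
  assumes free: "free_ultrafilter U"
begin

lemma U_nontrivial [simp]: "U \<noteq> bot"
  using free by (simp add: free_ultrafilter_def)

lemma U_le_sequentially: "U \<le> sequentially"
  using free by (simp add: free_ultrafilter_def)

lemma eventually_not_iff: "eventually (\<lambda>i. \<not> P i) U \<longleftrightarrow> \<not> eventually P U"
proof
  assume "eventually (\<lambda>i. \<not> P i) U"
  then show "\<not> eventually P U"
    using eventually_elim2[of "\<lambda>i. \<not> P i" U P "\<lambda>_. False"] by auto
qed (use free in \<open>auto simp: free_ultrafilter_def\<close>)

definition ulim :: "(nat \<Rightarrow> real) \<Rightarrow> real" where "ulim h = Lim U h"

lemma ulim_eqI: "(h \<longlongrightarrow> l) U \<Longrightarrow> ulim h = l"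
  by (simp add: ulim_def tendsto_Lim)

text \<open>
  By compactness the values have a cluster point, and an ultrafilter converges to its cluster points.
\<close>

lemma tendsto_ulim:
  assumes "\<And>i. \<bar>h i\<bar> \<le> C"
  shows "(h \<longlongrightarrow> ulim h) U"
proof -
  have "filtermap h U \<noteq> bot" by (simp add: filtermap_bot_iff)
  moreover have "eventually (\<lambda>x. x \<in> {-C..C}) (filtermap h U)"
    using assms by (auto simp: eventually_filtermap abs_le_iff minus_le_iff)
  ultimately obtain l where l: "inf (nhds l) (filtermap h U) \<noteq> bot"
    using compact_Icc[of "-C" C] unfolding compact_filter by blast
  have "eventually (\<lambda>i. P (h i)) U" if P: "eventually P (nhds l)" for P
  proof (rule ccontr)
    assume "\<not> eventually (\<lambda>i. P (h i)) U"
    then have "eventually (\<lambda>i. \<not> P (h i)) U" by (simp add: eventually_not_iff)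
    then have "eventually (\<lambda>x. \<not> P x) (filtermap h U)" by (simp add: eventually_filtermap)
    with P have "eventually (\<lambda>_. False) (inf (nhds l) (filtermap h U))"
      unfolding eventually_inf by blast
    with l show False by (simp add: trivial_limit_def)
  qed
  then have "(h \<longlongrightarrow> l) U" by (auto simp: filterlim_iff)
  then show ?thesis using ulim_eqI by blast
qed

end

section \<open>Averages and invariant means\<close>

definition avg :: "nat \<Rightarrow> (nat \<Rightarrow> real) \<Rightarrow> real" where
  "avg N g = (\<Sum>n=1..N. g n) / real N"

lemma avg_add: "avg N (\<lambda>n. g n + h n) = avg N g + avg N h"
  by (simp add: avg_def sum.distrib add_divide_distrib)

lemma avg_diff: "avg N (\<lambda>n. g n - h n) = avg N g - avg N h"
  by (simp add: avg_def sum_subtractf diff_divide_distrib)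

lemma avg_cmult: "avg N (\<lambda>n. c * g n) = c * avg N g"
  by (simp add: avg_def sum_distrib_left)

lemma avg_cong: "(\<And>n. g n = h n) \<Longrightarrow> avg N g = avg N h"
  by (simp add: avg_def)

lemma avg_mono: "(\<And>n. n \<le> N \<Longrightarrow> g n \<le> h n) \<Longrightarrow> avg N g \<le> avg N h"
  unfolding avg_def by (intro divide_right_mono sum_mono) auto

lemma avg_const: "N \<ge> 1 \<Longrightarrow> avg N (\<lambda>_. c) = c"
  by (simp add: avg_def)

lemma avg_const_le: "c \<ge> 0 \<Longrightarrow> avg N (\<lambda>_. c) \<le> c"
  by (cases "N = 0") (simp_all add: avg_def)

lemma avg_nonneg: "(\<And>n. 0 \<le> g n) \<Longrightarrow> 0 \<le> avg N g"
  by (simp add: avg_def sum_nonneg)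

lemma avg_abs: "\<bar>avg N g\<bar> \<le> avg N (\<lambda>n. \<bar>g n\<bar>)"
  by (simp add: avg_def divide_right_mono sum_abs)

lemma avg_abs_le:
  assumes "\<And>n. n \<le> N \<Longrightarrow> \<bar>g n\<bar> \<le> C"
  shows "\<bar>avg N g\<bar> \<le> C"
proof -
  have "0 \<le> C" using assms[of 0] by linarith
  have "\<bar>avg N g\<bar> \<le> avg N (\<lambda>n. \<bar>g n\<bar>)" by (rule avg_abs)
  also have "\<dots> \<le> avg N (\<lambda>_. C)" by (rule avg_mono) (rule assms)
  also have "\<dots> \<le> C" by (rule avg_const_le) fact
  finally show ?thesis .
qed

lemma avg_swap: "avg N (\<lambda>n. avg M (\<lambda>m. g n m)) = avg M (\<lambda>m. avg N (\<lambda>n. g n m))"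
proof -
  have "(\<Sum>n=1..N. (\<Sum>m=1..M. g n m) / real M) / real N = (\<Sum>n=1..N. \<Sum>m=1..M. g n m) / (real M * real N)"
    by (simp only: sum_divide_distrib[symmetric] divide_divide_eq_left)
  also have "\<dots> = (\<Sum>m=1..M. \<Sum>n=1..N. g n m) / (real N * real M)"
    by (subst sum.swap) (simp only: mult.commute)
  also have "\<dots> = (\<Sum>m=1..M. (\<Sum>n=1..N. g n m) / real N) / real M"
    by (simp only: sum_divide_distrib[symmetric] divide_divide_eq_left)
  finally show ?thesis by (simp only: avg_def)
qed

lemma avg_square_le: "(avg N g)\<^sup>2 \<le> avg N (\<lambda>n. (g n)\<^sup>2)"
proof (cases "N = 0")
  case False
  have "(\<Sum>n=1..N. g n)\<^sup>2 \<le> (\<Sum>n=1..N. (g n)\<^sup>2) * real N"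
    using sum_squared_le_sum_of_squares[of g "{1..N}"] by simp
  then have "(\<Sum>n=1..N. g n)\<^sup>2 / (real N)\<^sup>2 \<le> (\<Sum>n=1..N. (g n)\<^sup>2) * real N / (real N)\<^sup>2"
    by (rule divide_right_mono) simp
  also have "\<dots> = (\<Sum>n=1..N. (g n)\<^sup>2) / real N"
    using False by (simp add: power2_eq_square)
  finally show ?thesis
    by (simp only: avg_def power_divide)
qed (simp add: avg_def)

text \<open>
  Translating by one step only exchanges the two extreme terms of the sum.
\<close>

lemma avg_translate_error:
  fixes g :: "int \<Rightarrow> real"
  assumes C: "\<And>m. \<bar>g m\<bar> \<le> C"
  shows "\<bar>avg N (\<lambda>m. g (int m - int l)) - avg N (\<lambda>m. g (int m))\<bar> \<le> 2 * real l * C / real N"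
proof -
  have tel: "(\<Sum>m=1..N. g (int m - 1 - r)) - (\<Sum>m=1..N. g (int m - r)) = g (- r) - g (int N - r)" for r
    by (induction N) auto
  have "\<bar>(\<Sum>m=1..N. g (int m - int l)) - (\<Sum>m=1..N. g (int m))\<bar> \<le> 2 * real l * C"
  proof (induction l)
    case (Suc l)
    have "\<bar>(\<Sum>m=1..N. g (int m - int (Suc l))) - (\<Sum>m=1..N. g (int m - int l))\<bar> \<le> 2 * C"
    proof -
      have "(\<Sum>m=1..N. g (int m - int (Suc l))) = (\<Sum>m=1..N. g (int m - 1 - int l))"
        by (intro sum.cong refl arg_cong[where f = g]) simp
      then show ?thesis
        using tel[of "int l"] C[of "- int l"] C[of "int N - int l"] by linarith
    qed
    moreover have "2 * real (Suc l) * C = 2 * real l * C + 2 * C"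
      by (simp add: ring_distribs)
    ultimately show ?case using Suc by linarith
  qed simp
  then have "\<bar>(\<Sum>m=1..N. g (int m - int l)) - (\<Sum>m=1..N. g (int m))\<bar> / real N \<le> 2 * real l * C / real N"
    by (rule divide_right_mono) simp
  then show ?thesis
    unfolding avg_def diff_divide_distrib[symmetric] by simp
qed

text \<open>
  An algebra \<open>B\<close> of bounded functions on the points of a universe large enough to hold, next to a
  system, its product with the integers. The map \<open>tag n\<close> embeds the universe as its \<open>n\<close>-th copy in
  itself, with \<open>label\<close> and \<open>untag\<close> recovering \<open>n\<close> and the point, and \<open>glue_B\<close> assembles one
  function in \<open>B\<close> from a family of functions prescribed on the copies. Self-similarity of this kind
  keeps all systems of the induction on one type.
\<close>

locale function_system =
  fixes B :: "('x \<Rightarrow> real) set"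
    and S :: "int \<Rightarrow> 'x \<Rightarrow> 'x"
    and tag :: "nat \<Rightarrow> 'x \<Rightarrow> 'x" and label :: "'x \<Rightarrow> nat" and untag :: "'x \<Rightarrow> 'x"
  assumes const_B: "(\<lambda>_. c) \<in> B"
    and add_B: "f \<in> B \<Longrightarrow> g \<in> B \<Longrightarrow> (\<lambda>x. f x + g x) \<in> B"
    and mult_B: "f \<in> B \<Longrightarrow> g \<in> B \<Longrightarrow> (\<lambda>x. f x * g x) \<in> B"
    and bounded_B: "f \<in> B \<Longrightarrow> \<exists>C. \<forall>x. \<bar>f x\<bar> \<le> C"
    and shift_B: "f \<in> B \<Longrightarrow> (\<lambda>x. f (S m x)) \<in> B"
    and tag_B: "f \<in> B \<Longrightarrow> (\<lambda>x. f (tag n x)) \<in> B"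
    and glue_B: "(\<And>n. h n \<in> B) \<Longrightarrow> (\<And>n x. \<bar>h n x\<bar> \<le> C) \<Longrightarrow> (\<lambda>x. h (label x) (untag x)) \<in> B"
    and S_add: "S (l + m) x = S l (S m x)"
    and S_zero: "S 0 x = x"
    and label_tag: "label (tag n x) = n"
    and untag_tag: "untag (tag n x) = x"
    and S_tag: "S m (tag n x) = tag n (S m x)"
begin

lemma cmult_B: "f \<in> B \<Longrightarrow> (\<lambda>x. c * f x) \<in> B"
  by (intro mult_B const_B)

lemma diff_B:
  assumes "f \<in> B" "g \<in> B" shows "(\<lambda>x. f x - g x) \<in> B"
  using add_B[OF assms(1) cmult_B[OF assms(2), of "-1"]] by simp

lemma power2_B: "f \<in> B \<Longrightarrow> (\<lambda>x. (f x)\<^sup>2) \<in> B"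
  by (simp add: power2_eq_square mult_B)

lemma sum_B: "(\<And>n. n \<in> A \<Longrightarrow> g n \<in> B) \<Longrightarrow> (\<lambda>x. \<Sum>n\<in>A. g n x) \<in> B"
  by (induction A rule: infinite_finite_induct) (auto intro: const_B add_B)

lemma prod_B: "(\<And>n. n \<in> A \<Longrightarrow> g n \<in> B) \<Longrightarrow> (\<lambda>x. \<Prod>n\<in>A. g n x) \<in> B"
  by (induction A rule: infinite_finite_induct) (auto intro: const_B mult_B)

lemma avg_B: "(\<And>n. g n \<in> B) \<Longrightarrow> (\<lambda>x. avg N (\<lambda>n. g n x)) \<in> B"
  unfolding avg_def divide_inverse by (intro mult_B sum_B const_B)

lemmas B_intros = const_B add_B mult_B shift_B tag_B cmult_B diff_B power2_B sum_B prod_B avg_B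

text \<open>
  An invariant mean on \<open>B\<close>, playing the role of integration against the measure of a system. Different
  systems are different states on the same algebra.
\<close>

definition state :: "(('x \<Rightarrow> real) \<Rightarrow> real) \<Rightarrow> bool" where
  "state I \<longleftrightarrow>
     (\<forall>f\<in>B. \<forall>g\<in>B. I (\<lambda>x. f x + g x) = I f + I g) \<and>
     (\<forall>f\<in>B. \<forall>c. I (\<lambda>x. c * f x) = c * I f) \<and>
     (\<forall>f\<in>B. (\<forall>x. 0 \<le> f x) \<longrightarrow> 0 \<le> I f) \<and>
     I (\<lambda>_. 1) = 1 \<and>
     (\<forall>f\<in>B. \<forall>n. I (\<lambda>x. f (S n x)) = I f)"

context
  fixes I assumes I: "state I"
begin

lemma state_add: "f \<in> B \<Longrightarrow> g \<in> B \<Longrightarrow> I (\<lambda>x. f x + g x) = I f + I g"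
  using I by (simp add: state_def)

lemma state_cmult: "f \<in> B \<Longrightarrow> I (\<lambda>x. c * f x) = c * I f"
  using I by (simp add: state_def)

lemma state_nonneg: "f \<in> B \<Longrightarrow> (\<And>x. 0 \<le> f x) \<Longrightarrow> 0 \<le> I f"
  using I by (simp add: state_def)

lemma state_const: "I (\<lambda>_. c) = c"
  using state_cmult[OF const_B, of c 1] I by (simp add: state_def)

lemma state_shift: "f \<in> B \<Longrightarrow> I (\<lambda>x. f (S n x)) = I f"
  using I by (simp add: state_def)

lemma state_diff: "f \<in> B \<Longrightarrow> g \<in> B \<Longrightarrow> I (\<lambda>x. f x - g x) = I f - I g"
  using state_add[of f "\<lambda>x. (-1) * g x"] state_cmult[of g "-1"] cmult_B[of g "-1"] by simp

lemma state_mono: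
  assumes "f \<in> B" "g \<in> B" "\<And>x. f x \<le> g x" shows "I f \<le> I g"
  using state_nonneg[OF diff_B[OF assms(2,1)]] state_diff[OF assms(2,1)] assms(3) by simp

lemma state_abs_le:
  assumes f: "f \<in> B" and "\<And>x. \<bar>f x\<bar> \<le> C" shows "\<bar>I f\<bar> \<le> C"
proof -
  have "f x \<le> C" "- C \<le> f x" for x using assms(2)[of x] by auto
  then show ?thesis
    using state_mono[OF f const_B, of C] state_mono[OF const_B f, of "-C"] by (simp add: state_const abs_le_iff)
qed

lemma state_sum: "finite A \<Longrightarrow> (\<And>n. g n \<in> B) \<Longrightarrow> I (\<lambda>x. \<Sum>n\<in>A. g n x) = (\<Sum>n\<in>A. I (g n))"
  by (induction A rule: finite_induct) (simp_all add: state_const state_add sum_B)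

lemma state_avg: "(\<And>n. g n \<in> B) \<Longrightarrow> I (\<lambda>x. avg N (\<lambda>n. g n x)) = avg N (\<lambda>n. I (g n))"
  using state_cmult[OF sum_B, of "{1..N}" g "1 / real N"]
  by (simp add: avg_def state_sum)

text \<open>
  Jensen's inequality for the square, with the weights estimated by their bound.
\<close>

lemma state_avg_square_le:
  assumes c: "\<And>n. c n \<in> B" "\<And>n x. \<bar>c n x\<bar> \<le> K" and g: "\<And>n. g n \<in> B"
  shows "I (\<lambda>x. (avg N (\<lambda>n. c n x * g n x))\<^sup>2) \<le> K\<^sup>2 * avg N (\<lambda>n. I (\<lambda>x. (g n x)\<^sup>2))"
proof -
  have "(avg N (\<lambda>n. c n x * g n x))\<^sup>2 \<le> avg N (\<lambda>n. K\<^sup>2 * (g n x)\<^sup>2)" for x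
  proof -
    have "(c n x * g n x)\<^sup>2 \<le> K\<^sup>2 * (g n x)\<^sup>2" for n
      using c(2)[of n x] unfolding power_mult_distrib
      by (intro mult_right_mono) (auto simp: abs_le_square_iff[symmetric])
    then show ?thesis using avg_square_le avg_mono order_trans by meson
  qed
  then have "I (\<lambda>x. (avg N (\<lambda>n. c n x * g n x))\<^sup>2) \<le> I (\<lambda>x. avg N (\<lambda>n. K\<^sup>2 * (g n x)\<^sup>2))"
    by (intro state_mono B_intros c g)
  also have "\<dots> = K\<^sup>2 * avg N (\<lambda>n. I (\<lambda>x. (g n x)\<^sup>2))"
    by (simp add: state_avg state_cmult B_intros g avg_cmult)
  finally show ?thesis .
qed

lemma state_avg_shift_square_le:
  assumes c: "\<And>n. c n \<in> B" "\<And>n x. \<bar>c n x\<bar> \<le> K" and w: "w \<in> B"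
  shows "I (\<lambda>x. (avg N (\<lambda>n. c n x * w (S (b n) x)))\<^sup>2) \<le> K\<^sup>2 * I (\<lambda>x. (w x)\<^sup>2)"
proof -
  have "I (\<lambda>x. (avg N (\<lambda>n. c n x * w (S (b n) x)))\<^sup>2) \<le> K\<^sup>2 * avg N (\<lambda>n. I (\<lambda>x. (w (S (b n) x))\<^sup>2))"
    by (intro state_avg_square_le c shift_B w)
  also have "\<dots> = K\<^sup>2 * avg N (\<lambda>_. I (\<lambda>x. (w x)\<^sup>2))"
    using state_shift[OF power2_B[OF w]] by simp
  also have "\<dots> \<le> K\<^sup>2 * I (\<lambda>x. (w x)\<^sup>2)"
    by (intro mult_left_mono avg_const_le state_nonneg power2_B w) auto
  finally show ?thesis .
qed

text \<open>
  The product of the system given by \<open>I\<close> with the uniform probability space on \<open>{1..N}\<close>.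
\<close>

lemma state_tagged_average:
  assumes N: "N \<ge> 1"
  shows "state (\<lambda>g. avg N (\<lambda>m. I (\<lambda>x. g (tag m x))))"
proof -
  have "I (\<lambda>x. f (S n (tag m x))) = I (\<lambda>x. f (tag m x))" if "f \<in> B" for f n m
    using state_shift[OF tag_B[OF that]] by (simp add: S_tag)
  then show ?thesis
    unfolding state_def
    using N by (auto simp: state_add state_cmult state_const avg_add avg_cmult avg_const B_intros
        intro!: avg_nonneg state_nonneg)
qed

end

definition bseq :: "(nat \<Rightarrow> 'x \<Rightarrow> real) \<Rightarrow> bool" where
  "bseq F \<longleftrightarrow> (\<forall>i. F i \<in> B) \<and> (\<exists>C. \<forall>i x. \<bar>F i x\<bar> \<le> C)"

lemma bseqI: "(\<And>i. F i \<in> B) \<Longrightarrow> (\<And>i x. \<bar>F i x\<bar> \<le> C) \<Longrightarrow> bseq F"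
  by (auto simp: bseq_def)

lemma bseqD: "bseq F \<Longrightarrow> F i \<in> B"
  by (auto simp: bseq_def)

lemma bseq_bound: "bseq F \<Longrightarrow> \<exists>C\<ge>1. \<forall>i x. \<bar>F i x\<bar> \<le> C"
  unfolding bseq_def by (metis max.cobounded2 max.coboundedI1)

lemma bseq_const: "bseq (\<lambda>_ _. c)"
  by (rule bseqI[OF const_B, of "\<lambda>_. c" "\<bar>c\<bar>"]) simp

lemma bseq_add:
  assumes "bseq F" "bseq G" shows "bseq (\<lambda>i x. F i x + G i x)"
proof -
  obtain C where "C \<ge> 1" and C: "\<And>i x. \<bar>F i x\<bar> \<le> C" using bseq_bound[OF assms(1)] by blast
  obtain D where "D \<ge> 1" and D: "\<And>i x. \<bar>G i x\<bar> \<le> D" using bseq_bound[OF assms(2)] by blast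
  have "\<bar>F i x + G i x\<bar> \<le> C + D" for i x
    using C[of i x] D[of i x] by linarith
  with add_B[OF bseqD[OF assms(1)] bseqD[OF assms(2)]] show ?thesis
    by (rule bseqI)
qed

lemma bseq_mult:
  assumes "bseq F" "bseq G" shows "bseq (\<lambda>i x. F i x * G i x)"
proof -
  obtain C where C: "C \<ge> 1" "\<And>i x. \<bar>F i x\<bar> \<le> C" using bseq_bound[OF assms(1)] by blast
  obtain D where "D \<ge> 1" and D: "\<And>i x. \<bar>G i x\<bar> \<le> D" using bseq_bound[OF assms(2)] by blast
  have "\<bar>F i x * G i x\<bar> \<le> C * D" for i x
    using C D[of i x] unfolding abs_mult by (intro mult_mono) auto
  with mult_B[OF bseqD[OF assms(1)] bseqD[OF assms(2)]] show ?thesis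
    by (rule bseqI)
qed

lemma bseq_cmult: "bseq F \<Longrightarrow> bseq (\<lambda>i x. c * F i x)"
  by (intro bseq_mult bseq_const)

lemma bseq_diff: "bseq F \<Longrightarrow> bseq G \<Longrightarrow> bseq (\<lambda>i x. F i x - G i x)"
  using bseq_add[of F "\<lambda>i x. (-1) * G i x"] bseq_cmult[of G "-1"] by simp

lemma bseq_power2: "bseq F \<Longrightarrow> bseq (\<lambda>i x. (F i x)\<^sup>2)"
  by (simp add: power2_eq_square bseq_mult)

lemma bseq_avg:
  assumes "\<And>n i. g n i \<in> B" "\<And>n i x. \<bar>g n i x\<bar> \<le> C"
  shows "bseq (\<lambda>i x. avg (N i) (\<lambda>n. g n i x))"
proof (rule bseqI)
  show "(\<lambda>x. avg (N i) (\<lambda>n. g n i x)) \<in> B" for i by (rule avg_B) (rule assms)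
  show "\<bar>avg (N i) (\<lambda>n. g n i x)\<bar> \<le> C" for i x by (rule avg_abs_le) (rule assms)
qed

lemma prod_bounded:
  fixes k :: nat
  assumes "\<And>j. j < k \<Longrightarrow> bseq (f j)"
  obtains K where "K \<ge> 1" "\<And>i y. \<bar>\<Prod>j<k. f j i (y j)\<bar> \<le> K"
proof -
  have "\<exists>K\<ge>1. \<forall>i y. \<bar>\<Prod>j<k. f j i (y j)\<bar> \<le> K"
    using assms
  proof (induction k)
    case (Suc k)
    obtain K where K: "K \<ge> 1" "\<And>i y. \<bar>\<Prod>j<k. f j i (y j)\<bar> \<le> K" using Suc by force
    obtain C where C: "C \<ge> 1" "\<And>i x. \<bar>f k i x\<bar> \<le> C" using bseq_bound[OF Suc.prems[of k]] by auto
    have "1 * 1 \<le> K * C" using K(1) C(1) by (intro mult_mono) auto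
    moreover have "\<bar>\<Prod>j<Suc k. f j i (y j)\<bar> \<le> K * C" for i y
    proof -
      have "\<bar>\<Prod>j<k. f j i (y j)\<bar> * \<bar>f k i (y k)\<bar> \<le> K * C"
        using K(1) by (intro mult_mono K(2) C(2)) auto
      then show ?thesis by (simp add: abs_mult)
    qed
    ultimately show ?case by auto
  qed auto
  then show ?thesis using that by blast
qed

end

section \<open>Sequences of systems and their limits\<close>

text \<open>
  The exponents are indexed from \<open>0\<close>; they are fixed because the induction only ever drops the last of
  them.
\<close>

locale ultraproduct_system = ultrafilter U + function_system B S tag label untag
  for U :: "nat filter" and B :: "('x \<Rightarrow> real) set" and S tag label untag +
  fixes a :: "nat \<Rightarrow> int"
begin

text \<open>
  Integration on the ultraproduct of the systems given by \<open>I i\<close>.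
\<close>

definition lim_state :: "(nat \<Rightarrow> ('x \<Rightarrow> real) \<Rightarrow> real) \<Rightarrow> (nat \<Rightarrow> 'x \<Rightarrow> real) \<Rightarrow> real" where
  "lim_state I F = ulim (\<lambda>i. I i (F i))"

text \<open>
  Here \<open>N\<^sub>0\<close> is independent of \<open>i\<close>, whereas the set of indices \<open>i\<close> on which the two averages are close
  may depend on \<open>N\<close> and \<open>N'\<close>.
\<close>

definition L2_Cauchy :: "(nat \<Rightarrow> ('x \<Rightarrow> real) \<Rightarrow> real) \<Rightarrow> (nat \<Rightarrow> nat \<Rightarrow> 'x \<Rightarrow> real) \<Rightarrow> bool" where
  "L2_Cauchy I G \<longleftrightarrow> (\<forall>\<epsilon>>0. \<exists>N\<^sub>0. \<forall>N\<ge>N\<^sub>0. \<forall>N'\<ge>N\<^sub>0.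
     lim_state I (\<lambda>i x. (G N i x - G N' i x)\<^sup>2) \<le> \<epsilon>)"

definition multi_term :: "nat \<Rightarrow> (nat \<Rightarrow> 'x \<Rightarrow> real) \<Rightarrow> nat \<Rightarrow> 'x \<Rightarrow> real" where
  "multi_term k f n x = (\<Prod>j<k. f j (S (a j * int n) x))"

definition multi_avg :: "nat \<Rightarrow> (nat \<Rightarrow> 'x \<Rightarrow> real) \<Rightarrow> nat \<Rightarrow> 'x \<Rightarrow> real" where
  "multi_avg k f N x = avg N (\<lambda>n. multi_term k f n x)"

text \<open>
  The average with \<open>k + 1\<close> functions, seen as a linear operator applied to the last function.
\<close>

definition last_avg :: "nat \<Rightarrow> (nat \<Rightarrow> 'x \<Rightarrow> real) \<Rightarrow> ('x \<Rightarrow> real) \<Rightarrow> nat \<Rightarrow> 'x \<Rightarrow> real" where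
  "last_avg k f v N x = avg N (\<lambda>n. multi_term k f n x * v (S (a k * int n) x))"

text \<open>
  The statement proved by induction. Quantifying over all sequences of states is what makes the
  induction hypothesis applicable to the product systems of \<open>state_tagged_average\<close>, and thereby
  uniform in a parameter.
\<close>

definition norm_convergence :: "nat \<Rightarrow> bool" where
  "norm_convergence k \<longleftrightarrow> (\<forall>I f. (\<forall>i. state (I i)) \<longrightarrow> (\<forall>j<k. bseq (f j)) \<longrightarrow>
     L2_Cauchy I (\<lambda>N i. multi_avg k (\<lambda>j. f j i) N))"

lemma multi_avg_Suc: "multi_avg (Suc k) f N = last_avg k f (f k) N"
  by (simp add: multi_avg_def last_avg_def multi_term_def fun_eq_iff)

lemma multi_term_B: "(\<And>j. j < k \<Longrightarrow> f j \<in> B) \<Longrightarrow> multi_term k f n \<in> B"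
  unfolding multi_term_def[abs_def] by (rule prod_B) (simp add: shift_B)

lemma multi_term_bounded:
  assumes "\<And>j. j < k \<Longrightarrow> bseq (f j)"
  obtains K where "K \<ge> 1" "\<And>i n x. \<bar>multi_term k (\<lambda>j. f j i) n x\<bar> \<le> K"
  using prod_bounded[of k f] assms unfolding multi_term_def by metis

lemma bseq_multi_avg:
  assumes "\<And>j. j < k \<Longrightarrow> bseq (f j)"
  shows "bseq (\<lambda>i. multi_avg k (\<lambda>j. f j i) (N i))"
proof -
  obtain K where K: "\<And>i n x. \<bar>multi_term k (\<lambda>j. f j i) n x\<bar> \<le> K"
    using multi_term_bounded[of k f] assms by metis
  show ?thesis
    unfolding multi_avg_def[abs_def]
  proof (rule bseq_avg[where C = K])
    show "(\<lambda>x. multi_term k (\<lambda>j. f j i) n x) \<in> B" for n i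
      using multi_term_B[of k "\<lambda>j. f j i" n] assms bseqD by blast
  qed (rule K)
qed

lemma bseq_last_avg:
  assumes f: "\<And>j. j < k \<Longrightarrow> bseq (f j)" and v: "bseq v"
  shows "bseq (\<lambda>i. last_avg k (\<lambda>j. f j i) (v i) (N i))"
proof -
  obtain K where K: "K \<ge> 1" "\<And>i n x. \<bar>multi_term k (\<lambda>j. f j i) n x\<bar> \<le> K"
    using multi_term_bounded[of k f] f by metis
  obtain C where C: "C \<ge> 1" "\<And>i x. \<bar>v i x\<bar> \<le> C"
    using bseq_bound[OF v] by blast
  show ?thesis
    unfolding last_avg_def[abs_def]
  proof (rule bseq_avg)
    show "(\<lambda>x. multi_term k (\<lambda>j. f j i) n x * v i (S (a k * int n) x)) \<in> B" for n i
      using mult_B[OF multi_term_B[of k "\<lambda>j. f j i" n] shift_B[OF bseqD[OF v]]] f bseqD by blast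
    show "\<bar>multi_term k (\<lambda>j. f j i) n x * v i (S (a k * int n) x)\<bar> \<le> K * C" for n i x
      unfolding abs_mult using K(1) by (intro mult_mono K(2) C(2)) auto
  qed
qed

lemma last_avg_add_cmult:
  "last_avg k f (\<lambda>x. v x + t * w x) N x = last_avg k f v N x + t * last_avg k f w N x"
  unfolding last_avg_def avg_cmult[symmetric] avg_add[symmetric]
  by (rule avg_cong) (simp add: algebra_simps)

lemma last_avg_diff:
  "last_avg k f (\<lambda>x. v x - w x) N x = last_avg k f v N x - last_avg k f w N x"
  using last_avg_add_cmult[of k f v "-1" w N x] by simp

context
  fixes I :: "nat \<Rightarrow> ('x \<Rightarrow> real) \<Rightarrow> real"
  assumes I: "\<And>i. state (I i)"
begin

lemma lim_state_tendsto:
  assumes "bseq F" shows "((\<lambda>i. I i (F i)) \<longlongrightarrow> lim_state I F) U"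
proof -
  obtain C where C: "\<And>i x. \<bar>F i x\<bar> \<le> C" using bseq_bound[OF assms] by blast
  show ?thesis
    unfolding lim_state_def
    by (rule tendsto_ulim) (rule state_abs_le[OF I bseqD[OF assms] C])
qed

lemma lim_state_add:
  assumes F: "bseq F" and G: "bseq G"
  shows "lim_state I (\<lambda>i x. F i x + G i x) = lim_state I F + lim_state I G"
proof -
  have "(\<lambda>i. I i (\<lambda>x. F i x + G i x)) = (\<lambda>i. I i (F i) + I i (G i))"
    using state_add[OF I] bseqD[OF F] bseqD[OF G] by auto
  then show ?thesis
    using ulim_eqI[OF tendsto_add[OF lim_state_tendsto[OF F] lim_state_tendsto[OF G]]]
    by (simp add: lim_state_def)
qed

lemma lim_state_cmult:
  assumes F: "bseq F"
  shows "lim_state I (\<lambda>i x. c * F i x) = c * lim_state I F"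
proof -
  have "(\<lambda>i. I i (\<lambda>x. c * F i x)) = (\<lambda>i. c * I i (F i))"
    using state_cmult[OF I] bseqD[OF F] by auto
  then show ?thesis
    using ulim_eqI[OF tendsto_mult_left[OF lim_state_tendsto[OF F], of c]]
    by (simp add: lim_state_def)
qed

lemma lim_state_diff:
  assumes "bseq F" "bseq G"
  shows "lim_state I (\<lambda>i x. F i x - G i x) = lim_state I F - lim_state I G"
  using lim_state_add[OF assms(1) bseq_cmult[OF assms(2)], of "-1"] lim_state_cmult[OF assms(2), of "-1"]
  by simp

lemma lim_state_mono:
  assumes F: "bseq F" and G: "bseq G" and le: "\<And>i x. F i x \<le> G i x"
  shows "lim_state I F \<le> lim_state I G"
proof (rule tendsto_le[OF U_nontrivial lim_state_tendsto[OF G] lim_state_tendsto[OF F]])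
  show "eventually (\<lambda>i. I i (F i) \<le> I i (G i)) U"
    using state_mono[OF I bseqD[OF F] bseqD[OF G] le] by simp
qed

lemma lim_state_nonneg:
  assumes F: "bseq F" and "\<And>i x. 0 \<le> F i x"
  shows "0 \<le> lim_state I F"
  using lim_state_mono[OF bseq_const F, of 0] assms(2) state_const[OF I, of _ 0] ulim_eqI[OF tendsto_const, of 0]
  by (simp add: lim_state_def)

text \<open>
  Being Cauchy up to a given error is stable under summands that are eventually small. The constant
  comes from \<open>(p - r + q - s)\<^sup>2 \<le> 2(p - r)\<^sup>2 + 4q\<^sup>2 + 4s\<^sup>2\<close>.
\<close>

lemma L2_Cauchy_perturb:
  assumes G: "\<And>N. bseq (G N)" and H: "\<And>N. bseq (H N)" and cau: "L2_Cauchy I G"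
    and small: "\<exists>N\<^sub>0. \<forall>N\<ge>N\<^sub>0. lim_state I (\<lambda>i x. (H N i x)\<^sup>2) \<le> \<delta>" and \<delta>: "\<delta> > 0"
  shows "\<exists>N\<^sub>0. \<forall>N\<ge>N\<^sub>0. \<forall>N'\<ge>N\<^sub>0.
    lim_state I (\<lambda>i x. ((G N i x + H N i x) - (G N' i x + H N' i x))\<^sup>2) \<le> 10 * \<delta>"
proof -
  obtain N1 where N1: "\<And>N N'. N \<ge> N1 \<Longrightarrow> N' \<ge> N1 \<Longrightarrow> lim_state I (\<lambda>i x. (G N i x - G N' i x)\<^sup>2) \<le> \<delta>"
    using cau \<delta> unfolding L2_Cauchy_def by blast
  obtain N2 where N2: "\<And>N. N \<ge> N2 \<Longrightarrow> lim_state I (\<lambda>i x. (H N i x)\<^sup>2) \<le> \<delta>"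
    using small by blast
  have "lim_state I (\<lambda>i x. ((G N i x + H N i x) - (G N' i x + H N' i x))\<^sup>2) \<le> 10 * \<delta>"
    if "N \<ge> max N1 N2" "N' \<ge> max N1 N2" for N N'
  proof -
    have ineq: "((p + q) - (r + s))\<^sup>2 \<le> 2 * (p - r)\<^sup>2 + (4 * q\<^sup>2 + 4 * s\<^sup>2)" for p q r s :: real
    proof -
      have "2 * (p - r)\<^sup>2 + (4 * q\<^sup>2 + 4 * s\<^sup>2) - ((p + q) - (r + s))\<^sup>2
        = ((p - r) - (q - s))\<^sup>2 + 2 * (q + s)\<^sup>2" by (simp add: power2_eq_square algebra_simps)
      then show ?thesis by (smt (verit) zero_le_power2)
    qed
    have b: "bseq (\<lambda>i x. (G N i x - G N' i x)\<^sup>2)" "bseq (\<lambda>i x. (H N i x)\<^sup>2)" for N N'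
      by (intro bseq_power2 bseq_diff G H)+
    have "lim_state I (\<lambda>i x. ((G N i x + H N i x) - (G N' i x + H N' i x))\<^sup>2)
      \<le> lim_state I (\<lambda>i x. 2 * (G N i x - G N' i x)\<^sup>2 + (4 * (H N i x)\<^sup>2 + 4 * (H N' i x)\<^sup>2))"
      by (intro lim_state_mono bseq_power2 bseq_diff bseq_add bseq_cmult G H ineq)
    also have "\<dots> = 2 * lim_state I (\<lambda>i x. (G N i x - G N' i x)\<^sup>2)
        + (4 * lim_state I (\<lambda>i x. (H N i x)\<^sup>2) + 4 * lim_state I (\<lambda>i x. (H N' i x)\<^sup>2))"
      using b by (simp add: lim_state_add lim_state_cmult bseq_add bseq_cmult)
    also have "\<dots> \<le> 2 * \<delta> + (4 * \<delta> + 4 * \<delta>)"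
      using that by (intro add_mono mult_left_mono N1 N2) auto
    finally show ?thesis by simp
  qed
  then show ?thesis by blast
qed

lemma L2_Cauchy_add_cmult:
  assumes G: "\<And>N. bseq (G N)" and H: "\<And>N. bseq (H N)" and "L2_Cauchy I G" "L2_Cauchy I H"
  shows "L2_Cauchy I (\<lambda>N i x. G N i x + t * H N i x)"
  unfolding L2_Cauchy_def
proof (intro allI impI)
  fix \<epsilon> :: real assume \<epsilon>: "\<epsilon> > 0"
  define \<delta> where "\<delta> = \<epsilon> / (2 + 2 * t\<^sup>2)"
  have pos: "2 + 2 * t\<^sup>2 > 0" by (smt (verit) zero_le_power2)
  then have \<delta>: "\<delta> > 0" using \<epsilon> by (simp add: \<delta>_def)
  obtain N1 where N1: "\<And>N N'. N \<ge> N1 \<Longrightarrow> N' \<ge> N1 \<Longrightarrow> lim_state I (\<lambda>i x. (G N i x - G N' i x)\<^sup>2) \<le> \<delta>"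
    using assms(3) \<delta> unfolding L2_Cauchy_def by blast
  obtain N2 where N2: "\<And>N N'. N \<ge> N2 \<Longrightarrow> N' \<ge> N2 \<Longrightarrow> lim_state I (\<lambda>i x. (H N i x - H N' i x)\<^sup>2) \<le> \<delta>"
    using assms(4) \<delta> unfolding L2_Cauchy_def by blast
  have "lim_state I (\<lambda>i x. ((G N i x + t * H N i x) - (G N' i x + t * H N' i x))\<^sup>2) \<le> \<epsilon>"
    if "N \<ge> max N1 N2" "N' \<ge> max N1 N2" for N N'
  proof -
    have ineq: "((p + t * q) - (r + t * s))\<^sup>2 \<le> 2 * (p - r)\<^sup>2 + (2 * t\<^sup>2) * (q - s)\<^sup>2" for p q r s :: real
    proof -
      have "2 * (p - r)\<^sup>2 + (2 * t\<^sup>2) * (q - s)\<^sup>2 - ((p + t * q) - (r + t * s))\<^sup>2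
        = ((p - r) - t * (q - s))\<^sup>2" by (simp add: power2_eq_square algebra_simps)
      then show ?thesis by (smt (verit) zero_le_power2)
    qed
    have b: "bseq (\<lambda>i x. (G N i x - G N' i x)\<^sup>2)" "bseq (\<lambda>i x. (H N i x - H N' i x)\<^sup>2)"
      by (intro bseq_power2 bseq_diff G H)+
    have "lim_state I (\<lambda>i x. ((G N i x + t * H N i x) - (G N' i x + t * H N' i x))\<^sup>2)
      \<le> lim_state I (\<lambda>i x. 2 * (G N i x - G N' i x)\<^sup>2 + (2 * t\<^sup>2) * (H N i x - H N' i x)\<^sup>2)"
      by (intro lim_state_mono bseq_power2 bseq_diff bseq_add bseq_cmult G H ineq)
    also have "\<dots> = 2 * lim_state I (\<lambda>i x. (G N i x - G N' i x)\<^sup>2)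
        + (2 * t\<^sup>2) * lim_state I (\<lambda>i x. (H N i x - H N' i x)\<^sup>2)"
      using b by (simp only: lim_state_add lim_state_cmult bseq_cmult)
    also have "\<dots> \<le> 2 * \<delta> + (2 * t\<^sup>2) * \<delta>"
      using that by (intro add_mono mult_left_mono N1 N2) auto
    also have "\<dots> = (2 + 2 * t\<^sup>2) * \<delta>" by (simp add: ring_distribs)
    also have "\<dots> = \<epsilon>" using pos by (simp add: \<delta>_def)
    finally show ?thesis .
  qed
  then show "\<exists>N\<^sub>0. \<forall>N\<ge>N\<^sub>0. \<forall>N'\<ge>N\<^sub>0.
     lim_state I (\<lambda>i x. ((G N i x + t * H N i x) - (G N' i x + t * H N' i x))\<^sup>2) \<le> \<epsilon>"
    by blast
qed

end

section \<open>Dual averages\<close>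

text \<open>
  The image of \<open>h\<close> under the adjoint of the operator \<open>last_avg k f\<close>; this is the content of
  \<open>state_dual_avg\<close>.
\<close>

definition dual_avg :: "nat \<Rightarrow> (nat \<Rightarrow> 'x \<Rightarrow> real) \<Rightarrow> ('x \<Rightarrow> real) \<Rightarrow> nat \<Rightarrow> 'x \<Rightarrow> real" where
  "dual_avg k f h N x =
     avg N (\<lambda>m. (\<Prod>j<k. f j (S ((a j - a k) * int m) x)) * h (S (- a k * int m) x))"

lemma dual_avg_B:
  assumes "\<And>j. j < k \<Longrightarrow> f j \<in> B" "h \<in> B"
  shows "dual_avg k f h N \<in> B"
  unfolding dual_avg_def[abs_def]
  by (rule avg_B, rule mult_B, rule prod_B) (auto intro: shift_B assms)

lemma bseq_dual_avg:
  assumes f: "\<And>j. j < k \<Longrightarrow> bseq (f j)" and h: "bseq h"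
  shows "bseq (\<lambda>i. dual_avg k (\<lambda>j. f j i) (h i) (N i))"
proof -
  obtain K where K: "K \<ge> 1" "\<And>i y. \<bar>\<Prod>j<k. f j i (y j)\<bar> \<le> K"
    using prod_bounded[of k f] f by metis
  obtain C where C: "C \<ge> 1" "\<And>i x. \<bar>h i x\<bar> \<le> C"
    using bseq_bound[OF h] by blast
  show ?thesis
  proof (rule bseqI)
    show "dual_avg k (\<lambda>j. f j i) (h i) (N i) \<in> B" for i
      using dual_avg_B[of k "\<lambda>j. f j i"] f h bseqD by blast
    show "\<bar>dual_avg k (\<lambda>j. f j i) (h i) (N i) x\<bar> \<le> K * C" for i x
      unfolding dual_avg_def
    proof (rule avg_abs_le)
      fix m
      show "\<bar>(\<Prod>j<k. f j i (S ((a j - a k) * int m) x)) * h i (S (- a k * int m) x)\<bar> \<le> K * C"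
        unfolding abs_mult using K(1) by (intro mult_mono K(2) C(2)) auto
    qed
  qed
qed

text \<open>
  Each term of the average is translated by its own power of the transformation, which the state does
  not see.
\<close>

lemma state_dual_avg:
  assumes I: "state I" and f: "\<And>j. j < k \<Longrightarrow> f j \<in> B" and h: "h \<in> B" and u: "u \<in> B"
  shows "I (\<lambda>x. u x * dual_avg k f h N x) = I (\<lambda>x. h x * last_avg k f u N x)"
proof -
  define g where "g m x = h x * (multi_term k f m x * u (S (a k * int m) x))" for m x
  have gB: "g m \<in> B" for m
    unfolding g_def[abs_def] by (intro mult_B multi_term_B shift_B f h u)
  have shifted: "u x * ((\<Prod>j<k. f j (S ((a j - a k) * int m) x)) * h (S (- a k * int m) x))
      = g m (S (- a k * int m) x)" for m x
  proof -
    have "S (a k * int m) (S (- a k * int m) x) = x"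
      by (simp add: S_add[symmetric] S_zero)
    moreover have "S (a j * int m) (S (- a k * int m) x) = S ((a j - a k) * int m) x" for j
      by (simp add: S_add[symmetric] algebra_simps)
    ultimately show ?thesis by (simp add: g_def multi_term_def)
  qed
  have "I (\<lambda>x. u x * dual_avg k f h N x) = I (\<lambda>x. avg N (\<lambda>m. g m (S (- a k * int m) x)))"
    by (simp only: dual_avg_def avg_cmult[symmetric] shifted)
  also have "\<dots> = avg N (\<lambda>m. I (g m))"
    using gB by (simp only: state_avg[OF I] shift_B state_shift[OF I])
  also have "\<dots> = I (\<lambda>x. h x * last_avg k f u N x)"
    using state_avg[OF I gB, of N] by (simp add: g_def last_avg_def avg_cmult)
  finally show ?thesis .
qed

text \<open>
  Translating \<open>dual_avg k f h N\<close> by \<open>a\<^sub>kl\<close> amounts to shifting its summation variable \<open>m\<close> by \<open>l\<close> and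
  translating each \<open>f\<^sub>j\<close> by \<open>a\<^sub>jl\<close>, because \<open>(a\<^sub>j - a\<^sub>k)m + a\<^sub>kl = (a\<^sub>j - a\<^sub>k)(m - l) + a\<^sub>jl\<close>. Undoing the
  shift costs \<open>O(M/N)\<close>, and exchanging the two averages leaves, for each \<open>m\<close>, an average of \<open>k\<close>
  functions in \<open>l\<close>.
\<close>

lemma last_avg_of_dual_avg:
  assumes K: "\<And>y. \<bar>\<Prod>j<k. f j (y j)\<bar> \<le> K" and C: "\<And>x. \<bar>h x\<bar> \<le> C" "C \<ge> 0"
  shows "\<bar>last_avg k f (dual_avg k f h N) M x
      - avg N (\<lambda>m. h (S (- a k * int m) x)
          * multi_avg k (\<lambda>j y. f j y * f j (S ((a j - a k) * int m) y)) M x)\<bar>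
    \<le> 2 * K\<^sup>2 * C * real M / real N"
proof -
  have K0: "K \<ge> 0" using K[of "\<lambda>_. undefined"] by linarith
  define q where "q l m = (\<Prod>j<k. f j (S ((a j - a k) * m) (S (a j * int l) x))) * h (S (- a k * m) x)"
    for l and m :: int
  have q_bound: "\<bar>q l m\<bar> \<le> K * C" for l m
    unfolding q_def abs_mult by (intro mult_mono K C) (auto simp: K0 C)
  have "dual_avg k f h N (S (a k * int l) x) = avg N (\<lambda>m. q l (int m - int l))" for l
  proof -
    have "S ((a j - a k) * int m) (S (a k * int l) x)
        = S ((a j - a k) * (int m - int l)) (S (a j * int l) x)" for j m
      by (simp add: S_add[symmetric] algebra_simps)
    moreover have "S (- a k * int m) (S (a k * int l) x) = S (- a k * (int m - int l)) x" for m
      by (simp add: S_add[symmetric] algebra_simps)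
    ultimately show ?thesis by (simp only: dual_avg_def q_def)
  qed
  then have 1: "last_avg k f (dual_avg k f h N) M x
      = avg M (\<lambda>l. multi_term k f l x * avg N (\<lambda>m. q l (int m - int l)))"
    by (simp only: last_avg_def)
  have "avg N (\<lambda>m. h (S (- a k * int m) x)
          * multi_avg k (\<lambda>j y. f j y * f j (S ((a j - a k) * int m) y)) M x)
      = avg N (\<lambda>m. avg M (\<lambda>l. multi_term k f l x * q l (int m)))"
    unfolding multi_avg_def avg_cmult[symmetric] multi_term_def q_def
    by (simp add: prod.distrib mult_ac)
  also have "\<dots> = avg M (\<lambda>l. multi_term k f l x * avg N (\<lambda>m. q l (int m)))"
    by (subst avg_swap) (simp only: avg_cmult)
  finally have 2: "avg N (\<lambda>m. h (S (- a k * int m) x)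
          * multi_avg k (\<lambda>j y. f j y * f j (S ((a j - a k) * int m) y)) M x) = \<dots>" .
  show ?thesis
    unfolding 1 2 avg_diff[symmetric]
  proof (rule avg_abs_le)
    fix l assume l: "l \<le> M"
    have "\<bar>multi_term k f l x\<bar> * \<bar>avg N (\<lambda>m. q l (int m - int l)) - avg N (\<lambda>m. q l (int m))\<bar>
      \<le> K * (2 * real l * (K * C) / real N)"
      by (intro mult_mono avg_translate_error q_bound) (auto simp: multi_term_def K K0)
    also have "\<dots> = 2 * K\<^sup>2 * C * real l / real N"
      by (simp add: power2_eq_square)
    also have "\<dots> \<le> 2 * K\<^sup>2 * C * real M / real N"
      using l C by (intro divide_right_mono mult_left_mono) auto
    finally show "\<bar>multi_term k f l x * avg N (\<lambda>m. q l (int m - int l))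
        - multi_term k f l x * avg N (\<lambda>m. q l (int m))\<bar> \<le> 2 * K\<^sup>2 * C * real M / real N"
      by (simp only: abs_mult right_diff_distrib[symmetric])
  qed
qed

text \<open>
  The functions \<open>f\<^sub>j \<cdot> \<tau>\<^bsup>(a\<^sub>j-a\<^sub>k)m\<^esup>f\<^sub>j\<close> for all \<open>m\<close> are glued into single functions on the product of
  the \<open>i\<close>-th system with \<open>{1..N i}\<close>. The induction hypothesis there controls the differences of their
  averages in the mean over \<open>m\<close>, and this is all that is needed. The error from
  \<open>last_avg_of_dual_avg\<close> disappears in the limit because \<open>N i\<close> tends to infinity while \<open>M\<close> is fixed.
\<close>

lemma dual_avg_L2_Cauchy:
  assumes IH: "norm_convergence k" and I: "\<And>i. state (I i)"
    and f: "\<And>j. j < k \<Longrightarrow> bseq (f j)" and h: "bseq h"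
    and N: "\<And>i. N i \<ge> 1" "filterlim N at_top U"
  shows "L2_Cauchy I (\<lambda>M i. last_avg k (\<lambda>j. f j i) (dual_avg k (\<lambda>j. f j i) (h i) (N i)) M)"
    (is "L2_Cauchy I (\<lambda>M i. ?L i M)")
  unfolding L2_Cauchy_def
proof (intro allI impI)
  fix \<epsilon> :: real assume \<epsilon>: "\<epsilon> > 0"
  obtain K where K: "K \<ge> 1" "\<And>i y. \<bar>\<Prod>j<k. f j i (y j)\<bar> \<le> K"
    using prod_bounded[of k f] f by metis
  obtain C where C: "C \<ge> 1" "\<And>i x. \<bar>h i x\<bar> \<le> C"
    using bseq_bound[OF h] by blast
  define I' where "I' i g = avg (N i) (\<lambda>m. I i (\<lambda>x. g (tag m x)))" for i g
  have I': "state (I' i)" for i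
    unfolding I'_def[abs_def] by (rule state_tagged_average[OF I N(1)])
  define f' where "f' j i z = f j i (untag z) * f j i (S ((a j - a k) * int (label z)) (untag z))" for j i z
  have f': "bseq (f' j)" if j: "j < k" for j
  proof -
    obtain c where c: "c \<ge> 1" "\<And>i x. \<bar>f j i x\<bar> \<le> c"
      using bseq_bound[OF f[OF j]] by blast
    have bound: "\<bar>f j i x * f j i y\<bar> \<le> c * c" for i x y
      unfolding abs_mult using c(1) by (intro mult_mono c(2)) auto
    show ?thesis
    proof (rule bseqI)
      show "f' j i \<in> B" for i
        unfolding f'_def[abs_def]
        by (rule glue_B[where h = "\<lambda>n x. f j i x * f j i (S ((a j - a k) * int n) x)", OF _ bound])
           (intro mult_B shift_B bseqD[OF f[OF j]])
      show "\<bar>f' j i x\<bar> \<le> c * c" for i x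
        unfolding f'_def by (rule bound)
    qed
  qed
  have f'_tag: "multi_avg k (\<lambda>j. f' j i) M (tag m x)
      = multi_avg k (\<lambda>j y. f j i y * f j i (S ((a j - a k) * int m) y)) M x" for i M m x
    by (simp add: multi_avg_def multi_term_def f'_def S_tag label_tag untag_tag)
  define \<epsilon>' where "\<epsilon>' = \<epsilon> / (2 * C\<^sup>2)"
  have "\<epsilon>' > 0" using \<epsilon> C(1) by (simp add: \<epsilon>'_def)
  moreover have "L2_Cauchy I' (\<lambda>M i. multi_avg k (\<lambda>j. f' j i) M)"
    using IH I' f' unfolding norm_convergence_def by blast
  ultimately obtain N0 where N0: "\<And>M M'. M \<ge> N0 \<Longrightarrow> M' \<ge> N0 \<Longrightarrow> lim_state I' (\<lambda>i x.
      (multi_avg k (\<lambda>j. f' j i) M x - multi_avg k (\<lambda>j. f' j i) M' x)\<^sup>2) \<le> \<epsilon>'"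
    unfolding L2_Cauchy_def by blast
  have "lim_state I (\<lambda>i x. (?L i M x - ?L i M' x)\<^sup>2) \<le> \<epsilon>" if M: "M \<ge> N0" "M' \<ge> N0" for M M'
  proof -
    define D where "D i x = multi_avg k (\<lambda>j. f' j i) M x - multi_avg k (\<lambda>j. f' j i) M' x" for i x
    define E where "E i x = ?L i M x - ?L i M' x" for i x
    define R where "R i x = avg (N i) (\<lambda>m. h i (S (- a k * int m) x) * D i (tag m x))" for i x
    define c where "c = 2 * K\<^sup>2 * C * real M + 2 * K\<^sup>2 * C * real M'"
    have D: "bseq D"
      unfolding D_def[abs_def] by (intro bseq_diff bseq_multi_avg f')
    have E: "bseq E"
      unfolding E_def[abs_def] by (intro bseq_diff bseq_last_avg bseq_dual_avg f h)
    have R: "R i \<in> B" for i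
      unfolding R_def[abs_def] by (intro avg_B mult_B shift_B tag_B bseqD[OF h] bseqD[OF D])
    have ER: "\<bar>E i x - R i x\<bar> \<le> c / real (N i)" for i x
    proof -
      have "\<bar>?L i M x - avg (N i) (\<lambda>m. h i (S (- a k * int m) x) * multi_avg k (\<lambda>j. f' j i) M (tag m x))\<bar>
          \<le> 2 * K\<^sup>2 * C * real M / real (N i)" for M
        unfolding f'_tag using C(1) by (intro last_avg_of_dual_avg K C) auto
      from this[of M] this[of M'] show ?thesis
        unfolding E_def R_def D_def c_def by (simp add: right_diff_distrib avg_diff add_divide_distrib)
    qed
    have pointwise: "(E i x)\<^sup>2 \<le> 2 * (R i x)\<^sup>2 + 2 * (c / real (N i))\<^sup>2" for i x
    proof -
      have "(E i x - R i x)\<^sup>2 \<le> (c / real (N i))\<^sup>2"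
        using ER[of i x] by (metis abs_ge_zero abs_of_nonneg order_trans power2_le_iff_abs_le abs_le_square_iff)
      moreover have "(E i x)\<^sup>2 \<le> 2 * (R i x)\<^sup>2 + 2 * (E i x - R i x)\<^sup>2"
      proof -
        have "2 * (R i x)\<^sup>2 + 2 * (E i x - R i x)\<^sup>2 - (E i x)\<^sup>2 = (E i x - 2 * R i x)\<^sup>2"
          by (simp add: power2_eq_square algebra_simps)
        then show ?thesis by (smt (verit) zero_le_power2)
      qed
      ultimately show ?thesis by linarith
    qed
    have bound: "I i (\<lambda>x. (E i x)\<^sup>2) \<le> 2 * C\<^sup>2 * I' i (\<lambda>x. (D i x)\<^sup>2) + 2 * (c / real (N i))\<^sup>2" for i
    proof -
      have "I i (\<lambda>x. (E i x)\<^sup>2) \<le> I i (\<lambda>x. 2 * (R i x)\<^sup>2 + 2 * (c / real (N i))\<^sup>2)"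
        by (rule state_mono[OF I]) (auto intro!: add_B cmult_B power2_B R bseqD[OF E] const_B pointwise)
      also have "\<dots> = 2 * I i (\<lambda>x. (R i x)\<^sup>2) + 2 * (c / real (N i))\<^sup>2"
        by (simp only: state_add[OF I] state_cmult[OF I] state_const[OF I] cmult_B const_B power2_B[OF R])
      also have "I i (\<lambda>x. (R i x)\<^sup>2) \<le> C\<^sup>2 * I' i (\<lambda>x. (D i x)\<^sup>2)"
        unfolding R_def I'_def
        by (rule state_avg_square_le[OF I]) (intro shift_B tag_B bseqD[OF h] bseqD[OF D] C(2))+
      finally show ?thesis by simp
    qed
    have "((\<lambda>i. c / real (N i)) \<longlongrightarrow> 0) U"
      by (rule tendsto_divide_0[OF tendsto_const filterlim_at_top_imp_at_infinity[OF
            filterlim_compose[OF filterlim_real_sequentially N(2)]]])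
    then have "((\<lambda>i. 2 * C\<^sup>2 * I' i (\<lambda>x. (D i x)\<^sup>2) + 2 * (c / real (N i))\<^sup>2) \<longlongrightarrow>
        2 * C\<^sup>2 * lim_state I' (\<lambda>i x. (D i x)\<^sup>2) + 2 * 0\<^sup>2) U"
      by (intro tendsto_intros lim_state_tendsto[OF I'] bseq_power2 D)
    then have "lim_state I (\<lambda>i x. (E i x)\<^sup>2) \<le> 2 * C\<^sup>2 * lim_state I' (\<lambda>i x. (D i x)\<^sup>2) + 2 * 0\<^sup>2"
      by (rule tendsto_le[OF U_nontrivial _ lim_state_tendsto[OF I bseq_power2[OF E]]])
         (simp add: bound)
    also have "\<dots> \<le> 2 * C\<^sup>2 * \<epsilon>'"
      using N0[OF M] C(1) by (simp add: D_def)
    also have "\<dots> = \<epsilon>" using C(1) by (simp add: \<epsilon>'_def)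
    finally show ?thesis by (simp add: E_def)
  qed
  then show "\<exists>N\<^sub>0. \<forall>M\<ge>N\<^sub>0. \<forall>M'\<ge>N\<^sub>0. lim_state I (\<lambda>i x. (?L i M x - ?L i M' x)\<^sup>2) \<le> \<epsilon>"
    by blast
qed

section \<open>The induction on the number of functions\<close>

text \<open>
  For each length \<open>n\<close> whose average is large in the limit, the \<open>n\<close>-th average is large for
  \<open>U\<close>-almost every index \<open>i\<close>. Choosing for \<open>i\<close> the largest such \<open>n \<le> i\<close> gives lengths that tend to infinity along
  the ultrafilter, and \<open>u\<close> correlates with the dual average of its own average \<open>h\<close> because
  \<open>\<langle>u, \<sigma>\<rangle> = \<langle>h, h\<rangle>\<close>. The second estimate does not involve the supremum of \<open>u\<close>, which is important
  since \<open>u\<close> will be chosen after the error and without control of its supremum.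
\<close>

lemma large_averages_correlate:
  assumes I: "\<And>i. state (I i)"
    and f: "\<And>j. j < k \<Longrightarrow> bseq (f j)" and u: "bseq u"
    and K: "\<And>i y. \<bar>\<Prod>j<k. f j i (y j)\<bar> \<le> K"
    and large: "\<And>N\<^sub>0. \<exists>N\<ge>N\<^sub>0. \<delta> < lim_state I (\<lambda>i x. (last_avg k (\<lambda>j. f j i) (u i) N x)\<^sup>2)"
  shows "\<exists>N h. (\<forall>i. N i \<ge> 1) \<and> filterlim N at_top U \<and> bseq h \<and>
    \<delta> \<le> lim_state I (\<lambda>i x. u i x * dual_avg k (\<lambda>j. f j i) (h i) (N i) x) \<and>
    lim_state I (\<lambda>i x. (dual_avg k (\<lambda>j. f j i) (h i) (N i) x)\<^sup>2)
      \<le> K\<^sup>2 * (K\<^sup>2 * lim_state I (\<lambda>i x. (u i x)\<^sup>2))"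
proof -
  define large_at where
    "large_at i n \<longleftrightarrow> \<delta> < I i (\<lambda>x. (last_avg k (\<lambda>j. f j i) (u i) n x)\<^sup>2)" for i n
  \<comment> \<open>The value \<open>1\<close> is taken only outside a set in the ultrafilter.\<close>
  define N where
    "N i = (if \<exists>n\<in>{1..i}. large_at i n then Max {n \<in> {1..i}. large_at i n} else 1)" for i
  have N_attained: "N i \<in> {n \<in> {1..i}. large_at i n}" if "\<exists>n\<in>{1..i}. large_at i n" for i
  proof -
    have "Max {n \<in> {1..i}. large_at i n} \<in> {n \<in> {1..i}. large_at i n}"
      using that by (intro Max_in) auto
    then show ?thesis using that by (simp only: N_def if_True)
  qed
  have N_ge1: "N i \<ge> 1" for i
    using N_attained[of i] by (cases "\<exists>n\<in>{1..i}. large_at i n") (auto simp: N_def)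
  have ev: "eventually (\<lambda>i. N0 \<le> N i \<and> large_at i (N i)) U" for N0
  proof -
    obtain n where n: "n \<ge> max N0 1" "\<delta> < lim_state I (\<lambda>i x. (last_avg k (\<lambda>j. f j i) (u i) n x)\<^sup>2)"
      using large by blast
    have "bseq (\<lambda>i x. (last_avg k (\<lambda>j. f j i) (u i) n x)\<^sup>2)"
      by (intro bseq_power2 bseq_last_avg f u)
    then have "eventually (\<lambda>i. large_at i n) U"
      using order_tendstoD(1)[OF lim_state_tendsto[OF I] n(2)] by (simp add: large_at_def)
    moreover have "eventually (\<lambda>i. n \<le> i) U"
      using U_le_sequentially eventually_ge_at_top filter_leD by blast
    ultimately show ?thesis
    proof eventually_elim
      case (elim i)
      then have ex: "\<exists>n\<in>{1..i}. large_at i n" using n(1) by auto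
      then have "n \<le> N i"
        unfolding N_def using elim n(1) by (auto intro!: Max_ge)
      then show ?case using N_attained[OF ex] n(1) by auto
    qed
  qed
  have N_lim: "filterlim N at_top U"
    unfolding filterlim_at_top
  proof
    show "eventually (\<lambda>i. Z \<le> N i) U" for Z
      using ev[of Z] by eventually_elim simp
  qed
  define h where "h i = last_avg k (\<lambda>j. f j i) (u i) (N i)" for i
  have h: "bseq h"
    unfolding h_def[abs_def] by (intro bseq_last_avg f u)
  define \<sigma> where "\<sigma> i = dual_avg k (\<lambda>j. f j i) (h i) (N i)" for i
  have \<sigma>: "bseq \<sigma>"
    unfolding \<sigma>_def[abs_def] by (intro bseq_dual_avg f h)
  have B: "f j i \<in> B" if "j < k" for i j using bseqD[OF f[OF that]] .
  have "\<delta> \<le> lim_state I (\<lambda>i x. u i x * \<sigma> i x)"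
  proof (rule tendsto_lowerbound[OF lim_state_tendsto[OF I bseq_mult[OF u \<sigma>]]])
    show "eventually (\<lambda>i. \<delta> \<le> I i (\<lambda>x. u i x * \<sigma> i x)) U"
      using ev[of 0]
    proof eventually_elim
      case (elim i)
      have "I i (\<lambda>x. u i x * \<sigma> i x) = I i (\<lambda>x. (h i x)\<^sup>2)"
        using state_dual_avg[OF I[of i], of k "\<lambda>j. f j i" "h i" "u i" "N i"] B bseqD[OF h] bseqD[OF u]
        by (simp add: \<sigma>_def h_def power2_eq_square)
      then show ?case using elim by (simp add: large_at_def h_def)
    qed
  qed simp
  moreover have "lim_state I (\<lambda>i x. (\<sigma> i x)\<^sup>2) \<le> K\<^sup>2 * (K\<^sup>2 * lim_state I (\<lambda>i x. (u i x)\<^sup>2))"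
  proof (rule tendsto_le[OF U_nontrivial])
    show "((\<lambda>i. K\<^sup>2 * (K\<^sup>2 * I i (\<lambda>x. (u i x)\<^sup>2))) \<longlongrightarrow> K\<^sup>2 * (K\<^sup>2 * lim_state I (\<lambda>i x. (u i x)\<^sup>2))) U"
      by (intro tendsto_intros lim_state_tendsto[OF I] bseq_power2 u)
    show "((\<lambda>i. I i (\<lambda>x. (\<sigma> i x)\<^sup>2)) \<longlongrightarrow> lim_state I (\<lambda>i x. (\<sigma> i x)\<^sup>2)) U"
      by (intro lim_state_tendsto[OF I] bseq_power2 \<sigma>)
    have "I i (\<lambda>x. (\<sigma> i x)\<^sup>2) \<le> K\<^sup>2 * (K\<^sup>2 * I i (\<lambda>x. (u i x)\<^sup>2))" for i
    proof -
      have "I i (\<lambda>x. (\<sigma> i x)\<^sup>2) \<le> K\<^sup>2 * I i (\<lambda>x. (h i x)\<^sup>2)"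
        unfolding \<sigma>_def dual_avg_def
        by (rule state_avg_shift_square_le[OF I]) (auto intro!: prod_B shift_B B K bseqD[OF h])
      moreover have "I i (\<lambda>x. (h i x)\<^sup>2) \<le> K\<^sup>2 * I i (\<lambda>x. (u i x)\<^sup>2)"
        unfolding h_def last_avg_def
        by (rule state_avg_shift_square_le[OF I])
           (auto intro!: prod_B shift_B B bseqD[OF u] simp: multi_term_def K)
      ultimately show ?thesis by (meson mult_left_mono order_trans zero_le_power2)
    qed
    then show "eventually (\<lambda>i. I i (\<lambda>x. (\<sigma> i x)\<^sup>2) \<le> K\<^sup>2 * (K\<^sup>2 * I i (\<lambda>x. (u i x)\<^sup>2))) U"
      by simp
  qed
  ultimately show ?thesis
    using N_ge1 N_lim h by (auto simp: \<sigma>_def)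
qed

text \<open>
  A quadratic function of \<open>t\<close> that drops by at most \<open>\<eta>\<close> has a small linear coefficient; the
  optimal choice is \<open>t = \<delta> / W\<close>.
\<close>

lemma near_minimizer_near_orthogonal:
  assumes I: "\<And>i. state (I i)" and u: "bseq u" and \<sigma>: "bseq \<sigma>"
    and min: "\<And>t. lim_state I (\<lambda>i x. (u i x)\<^sup>2) \<le> lim_state I (\<lambda>i x. (u i x - t * \<sigma> i x)\<^sup>2) + \<eta>"
    and W: "W > 0" "lim_state I (\<lambda>i x. (\<sigma> i x)\<^sup>2) \<le> W"
    and \<delta>: "\<delta> \<ge> 0" "\<delta> \<le> lim_state I (\<lambda>i x. u i x * \<sigma> i x)"
  shows "\<delta>\<^sup>2 \<le> \<eta> * W"
proof -
  define t where "t = \<delta> / W"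
  have t: "t \<ge> 0" using W \<delta> by (simp add: t_def)
  have "lim_state I (\<lambda>i x. (u i x - t * \<sigma> i x)\<^sup>2)
      = lim_state I (\<lambda>i x. ((u i x)\<^sup>2 - (2 * t) * (u i x * \<sigma> i x)) + t\<^sup>2 * (\<sigma> i x)\<^sup>2)"
    by (simp add: power2_eq_square algebra_simps)
  also have "\<dots> = lim_state I (\<lambda>i x. (u i x)\<^sup>2) - 2 * t * lim_state I (\<lambda>i x. u i x * \<sigma> i x)
      + t\<^sup>2 * lim_state I (\<lambda>i x. (\<sigma> i x)\<^sup>2)"
    by (simp only: lim_state_add[OF I] lim_state_diff[OF I] lim_state_cmult[OF I]
        bseq_diff bseq_cmult bseq_mult bseq_power2 u \<sigma>)
  finally have "2 * t * lim_state I (\<lambda>i x. u i x * \<sigma> i x) \<le> t\<^sup>2 * lim_state I (\<lambda>i x. (\<sigma> i x)\<^sup>2) + \<eta>"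
    using min[of t] by linarith
  moreover have "2 * t * \<delta> \<le> 2 * t * lim_state I (\<lambda>i x. u i x * \<sigma> i x)"
    using t \<delta>(2) by (intro mult_left_mono) auto
  moreover have "t\<^sup>2 * lim_state I (\<lambda>i x. (\<sigma> i x)\<^sup>2) \<le> t\<^sup>2 * W"
    by (intro mult_left_mono W) auto
  ultimately have "2 * t * \<delta> \<le> t\<^sup>2 * W + \<eta>" by linarith
  moreover have "2 * t * \<delta> = 2 * (\<delta>\<^sup>2 / W)" "t\<^sup>2 * W = \<delta>\<^sup>2 / W"
    using W by (simp_all add: t_def power2_eq_square)
  ultimately have "\<delta>\<^sup>2 / W \<le> \<eta>" by linarith
  then show ?thesis using W by (simp add: divide_le_eq)
qed

lemma norm_convergence_Suc:
  assumes IH: "norm_convergence k"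
  shows "norm_convergence (Suc k)"
  unfolding norm_convergence_def
proof (intro allI impI)
  fix I :: "nat \<Rightarrow> ('x \<Rightarrow> real) \<Rightarrow> real" and f :: "nat \<Rightarrow> nat \<Rightarrow> 'x \<Rightarrow> real"
  assume "\<forall>i. state (I i)" and "\<forall>j<Suc k. bseq (f j)"
  then have I: "\<And>i. state (I i)" and f: "\<And>j. j < k \<Longrightarrow> bseq (f j)" and w: "bseq (f k)" by auto
  obtain K where K: "K \<ge> 1" "\<And>i y. \<bar>\<Prod>j<k. f j i (y j)\<bar> \<le> K"
    using prod_bounded[of k f] f by metis
  define A where "A v N i = last_avg k (\<lambda>j. f j i) (v i) N" for v N i
  define Q where "Q F = lim_state I (\<lambda>i x. (F i x)\<^sup>2)" for F
  define V where "V = {v. bseq v \<and> L2_Cauchy I (A v)}"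
  have A: "bseq (A v N)" if "bseq v" for v N
    unfolding A_def[abs_def] by (intro bseq_last_avg f that)
  have Q_nonneg: "Q F \<ge> 0" if "bseq F" for F
    unfolding Q_def by (rule lim_state_nonneg[OF I]) (simp_all add: bseq_power2 that)
  have V_add: "(\<lambda>i x. v i x + t * \<sigma> i x) \<in> V" if "v \<in> V" "\<sigma> \<in> V" for v \<sigma> t
  proof -
    have v: "bseq v" "L2_Cauchy I (A v)" and \<sigma>: "bseq \<sigma>" "L2_Cauchy I (A \<sigma>)"
      using that by (auto simp: V_def)
    have "A (\<lambda>i x. v i x + t * \<sigma> i x) = (\<lambda>N i x. A v N i x + t * A \<sigma> N i x)"
      by (intro ext) (simp add: A_def last_avg_add_cmult)
    then show ?thesis
      using L2_Cauchy_add_cmult[OF I A[OF v(1)] A[OF \<sigma>(1)] v(2) \<sigma>(2)] v(1) \<sigma>(1)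
      by (simp add: V_def bseq_add bseq_cmult)
  qed
  have zero: "(\<lambda>_ _. 0) \<in> V"
  proof -
    have "A (\<lambda>_ _. 0) = (\<lambda>_ _ _. 0)"
      by (intro ext) (simp add: A_def last_avg_def avg_def)
    then show ?thesis
      by (auto simp: V_def bseq_const L2_Cauchy_def lim_state_def state_const[OF I] ulim_eqI[OF tendsto_const])
  qed
  define d where "d = (INF v\<in>V. Q (\<lambda>i x. f k i x - v i x))"
  have bdd: "bdd_below ((\<lambda>v. Q (\<lambda>i x. f k i x - v i x)) ` V)"
    by (rule bdd_belowI2[of _ 0]) (auto intro!: Q_nonneg bseq_diff w simp: V_def)
  have d_le: "d \<le> Q (\<lambda>i x. f k i x - v i x)" if "v \<in> V" for v
    unfolding d_def by (rule cINF_lower[OF bdd that])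
  show "L2_Cauchy I (\<lambda>N i. multi_avg (Suc k) (\<lambda>j. f j i) N)"
    unfolding L2_Cauchy_def multi_avg_Suc
  proof (intro allI impI)
    fix \<epsilon> :: real assume \<epsilon>: "\<epsilon> > 0"
    \<comment> \<open>The factor is the one lost in \<open>L2_Cauchy_perturb\<close>.\<close>
    define \<delta> where "\<delta> = \<epsilon> / 10"
    have \<delta>: "\<delta> > 0" using \<epsilon> by (simp add: \<delta>_def)
    define W where "W = K\<^sup>2 * (K\<^sup>2 * (Q (f k) + 1))"
    have W: "W > 0" using K(1) Q_nonneg[OF w] by (simp add: W_def)
    \<comment> \<open>Small enough to contradict \<open>\<delta>\<^sup>2 \<le> \<eta> W\<close>; at most \<open>1\<close> so that \<open>W\<close> bounds the dual averages.\<close>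
    define \<eta> where "\<eta> = min 1 (\<delta>\<^sup>2 / (2 * W))"
    have \<eta>: "\<eta> > 0" using \<delta> W by (simp add: \<eta>_def)
    have "\<exists>v\<in>V. Q (\<lambda>i x. f k i x - v i x) < d + \<eta>"
      using cInf_lessD[of "(\<lambda>v. Q (\<lambda>i x. f k i x - v i x)) ` V" "d + \<eta>"] zero \<eta> by (auto simp: d_def)
    then obtain v where v: "v \<in> V" "Q (\<lambda>i x. f k i x - v i x) < d + \<eta>" by blast
    define u where "u i x = f k i x - v i x" for i x
    have v_bseq: "bseq v" and v_Cauchy: "L2_Cauchy I (A v)" using v(1) by (auto simp: V_def)
    have u: "bseq u" unfolding u_def[abs_def] by (intro bseq_diff w v_bseq)
    have Qu: "Q u < d + \<eta>" using v(2) by (simp add: u_def[abs_def])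
    have u_small: "\<exists>N\<^sub>0. \<forall>N\<ge>N\<^sub>0. Q (A u N) \<le> \<delta>"
    proof (rule ccontr)
      assume "\<not> ?thesis"
      then have large: "\<exists>N\<ge>N\<^sub>0. \<delta> < lim_state I (\<lambda>i x. (last_avg k (\<lambda>j. f j i) (u i) N x)\<^sup>2)" for N\<^sub>0
        by (auto simp: Q_def A_def not_le)
      obtain N h where Nh: "\<And>i. N i \<ge> 1" "filterlim N at_top U" "bseq h"
        and corr: "\<delta> \<le> lim_state I (\<lambda>i x. u i x * dual_avg k (\<lambda>j. f j i) (h i) (N i) x)"
        and size: "lim_state I (\<lambda>i x. (dual_avg k (\<lambda>j. f j i) (h i) (N i) x)\<^sup>2)
            \<le> K\<^sup>2 * (K\<^sup>2 * lim_state I (\<lambda>i x. (u i x)\<^sup>2))"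
        using large_averages_correlate[where I = I, OF I f u K(2) large] by blast
      define \<sigma> where "\<sigma> i = dual_avg k (\<lambda>j. f j i) (h i) (N i)" for i
      have \<sigma>: "bseq \<sigma>" unfolding \<sigma>_def[abs_def] by (intro bseq_dual_avg f Nh)
      have \<sigma>V: "\<sigma> \<in> V"
        using dual_avg_L2_Cauchy[OF IH I f Nh(3,1,2)] \<sigma> by (simp add: V_def A_def[abs_def] \<sigma>_def)
      have min: "Q u \<le> Q (\<lambda>i x. u i x - t * \<sigma> i x) + \<eta>" for t
        using d_le[OF V_add[OF v(1) \<sigma>V, of t]] Qu by (simp add: u_def algebra_simps)
      have "Q u \<le> Q (f k) + 1"
        using Qu d_le[OF zero] by (simp add: \<eta>_def)
      then have "K\<^sup>2 * (K\<^sup>2 * Q u) \<le> W"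
        unfolding W_def by (intro mult_left_mono) auto
      then have "Q \<sigma> \<le> W" using size by (simp add: Q_def \<sigma>_def)
      then have "\<delta>\<^sup>2 \<le> \<eta> * W"
        using near_minimizer_near_orthogonal[where I = I, OF I u \<sigma>, where \<eta> = \<eta> and W = W and \<delta> = \<delta>] min W \<delta> corr by (simp add: Q_def \<sigma>_def)
      also have "\<dots> \<le> \<delta>\<^sup>2 / (2 * W) * W"
        using W by (intro mult_right_mono) (auto simp: \<eta>_def)
      also have "\<dots> = \<delta>\<^sup>2 / 2" using W by simp
      finally show False using \<delta> by simp
    qed
    have split: "last_avg k (\<lambda>j. f j i) (f k i) N x = A v N i x + A u N i x" for N i x
      unfolding A_def u_def by (simp add: last_avg_diff)
    show "\<exists>N\<^sub>0. \<forall>N\<ge>N\<^sub>0. \<forall>N'\<ge>N\<^sub>0. lim_state I (\<lambda>i x.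
        (last_avg k (\<lambda>j. f j i) (f k i) N x - last_avg k (\<lambda>j. f j i) (f k i) N' x)\<^sup>2) \<le> \<epsilon>"
      using L2_Cauchy_perturb[OF I A[OF v_bseq] A[OF u] v_Cauchy u_small[unfolded Q_def] \<delta>]
      by (simp add: split \<delta>_def)
  qed
qed

theorem norm_convergence_all: "norm_convergence k"
proof (induction k)
  case 0
  show ?case
    unfolding norm_convergence_def L2_Cauchy_def
  proof (intro allI impI)
    fix I :: "nat \<Rightarrow> ('x \<Rightarrow> real) \<Rightarrow> real" and f :: "nat \<Rightarrow> nat \<Rightarrow> 'x \<Rightarrow> real" and \<epsilon> :: real
    assume I: "\<forall>i. state (I i)" and \<epsilon>: "\<epsilon> > 0"
    have "lim_state I (\<lambda>i x. (multi_avg 0 (\<lambda>j. f j i) N x - multi_avg 0 (\<lambda>j. f j i) N' x)\<^sup>2) \<le> \<epsilon>"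
      if "N \<ge> 1" "N' \<ge> 1" for N N'
    proof -
      have "multi_avg 0 (\<lambda>j. f j i) N x - multi_avg 0 (\<lambda>j. f j i) N' x = 0" for i x
        using that by (simp add: multi_avg_def multi_term_def avg_const)
      moreover have "I i (\<lambda>_. 0) = 0" for i using state_const I by blast
      ultimately show ?thesis
        using \<epsilon> by (simp add: lim_state_def ulim_eqI[OF tendsto_const])
    qed
    then show "\<exists>N\<^sub>0. \<forall>N\<ge>N\<^sub>0. \<forall>N'\<ge>N\<^sub>0.
        lim_state I (\<lambda>i x. (multi_avg 0 (\<lambda>j. f j i) N x - multi_avg 0 (\<lambda>j. f j i) N' x)\<^sup>2) \<le> \<epsilon>"
      by blast
  qed
qed (rule norm_convergence_Suc)

end

section \<open>Powers of the transformation and real functions\<close>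

context measure_preserving_system
begin

abbreviation T_inv :: "'a \<Rightarrow> 'a" where "T_inv \<equiv> the_inv_into (space M) T"

lemma T_inv_T: "x \<in> space M \<Longrightarrow> T_inv (T x) = x"
  using bij_betw_T by (simp add: bij_betw_def the_inv_into_f_f)

lemma T_T_inv: "x \<in> space M \<Longrightarrow> T (T_inv x) = x"
  using bij_betw_T by (auto simp: bij_betw_def intro: f_the_inv_into_f)

lemma distr_T: "distr M M T = M"
  by (rule measure_eqI) (auto simp: emeasure_distr measurable_T emeasure_vimage_T)

lemma distr_T_inv: "distr M M T_inv = M"
proof -
  have "distr M M T_inv = distr (distr M M T) M T_inv" by (simp add: distr_T)
  also have "\<dots> = distr M M (T_inv \<circ> T)"
    by (rule distr_distr[OF measurable_inv_T measurable_T])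
  also have "\<dots> = distr M M (\<lambda>x. x)"
    by (rule distr_cong) (auto simp: T_inv_T)
  finally show ?thesis by simp
qed

lemma funpow_preserving:
  assumes F: "F \<in> measurable M M" "distr M M F = M"
  shows "(F ^^ n) \<in> measurable M M \<and> distr M M (F ^^ n) = M"
proof (induction n)
  case 0
  then show ?case by (simp add: id_def)
next
  case (Suc n)
  have "distr M M (F \<circ> F ^^ n) = distr (distr M M (F ^^ n)) M F"
    using Suc F by (intro distr_distr[symmetric]) auto
  then show ?case using Suc F by (auto simp: o_def)
qed

lemma measurable_int_iterate: "int_iterate M T m \<in> measurable M M"
  and distr_int_iterate: "distr M M (int_iterate M T m) = M"
  using funpow_preserving[OF measurable_T distr_T] funpow_preserving[OF measurable_inv_T distr_T_inv]
  by (auto simp: int_iterate_def)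

lemma int_iterate_space: "x \<in> space M \<Longrightarrow> int_iterate M T m x \<in> space M"
  using measurable_int_iterate by (rule measurable_space)

lemma int_iterate_succ:
  assumes x: "x \<in> space M"
  shows "int_iterate M T (m + 1) x = T (int_iterate M T m x)"
proof (cases "m \<ge> 0")
  case True
  then have "nat (m + 1) = Suc (nat m)" by simp
  with True show ?thesis by (simp add: int_iterate_def)
next
  case False
  define n where "n = nat (- m - 1)"
  have m: "m = - int n - 1" using False by (simp add: n_def)
  have "(T_inv ^^ n) x \<in> space M"
    using funpow_preserving[OF measurable_inv_T distr_T_inv] x measurable_space by metis
  then have "T ((T_inv ^^ Suc n) x) = (T_inv ^^ n) x" by (simp add: T_T_inv)
  moreover have "nat (1 + int n) = Suc n" by simp
  ultimately show ?thesis by (auto simp: m int_iterate_def)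
qed

lemma int_iterate_pred:
  assumes x: "x \<in> space M"
  shows "int_iterate M T (m - 1) x = T_inv (int_iterate M T m x)"
  using int_iterate_succ[OF x, of "m - 1"] T_inv_T[OF int_iterate_space[OF x], of "m - 1"] by simp

lemma int_iterate_add:
  assumes x: "x \<in> space M"
  shows "int_iterate M T (l + m) x = int_iterate M T l (int_iterate M T m x)"
proof -
  have y: "int_iterate M T m x \<in> space M" by (rule int_iterate_space[OF x])
  show ?thesis
  proof (induction l rule: int_induct[where k = 0])
    case base
    then show ?case by (simp add: int_iterate_def)
  next
    case (step1 i)
    have "int_iterate M T (i + 1 + m) x = T (int_iterate M T (i + m) x)"
      using int_iterate_succ[OF x, of "i + m"] by (simp add: algebra_simps)
    then show ?case using step1 int_iterate_succ[OF y, of i] by simp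
  next
    case (step2 i)
    have "int_iterate M T (i - 1 + m) x = T_inv (int_iterate M T (i + m) x)"
      using int_iterate_pred[OF x, of "i + m"] by (simp add: algebra_simps)
    then show ?case using step2 int_iterate_pred[OF y, of i] by simp
  qed
qed

text \<open>
  The powers of the transformation, extended by the identity outside the space, so that the group law
  holds at every point of the type.
\<close>

definition power_map :: "int \<Rightarrow> 'a \<Rightarrow> 'a" where
  "power_map m x = (if x \<in> space M then int_iterate M T m x else x)"

lemma power_map_add: "power_map (l + m) x = power_map l (power_map m x)"
  by (simp add: power_map_def int_iterate_add int_iterate_space)

lemma measurable_power_map [measurable]: "power_map m \<in> measurable M M"
  using measurable_int_iterate[of m] by (subst measurable_cong[OF _ ]) (auto simp: power_map_def)

lemma distr_power_map: "distr M M (power_map m) = M"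
proof -
  have "distr M M (power_map m) = distr M M (int_iterate M T m)"
    by (rule distr_cong) (auto simp: power_map_def)
  then show ?thesis by (simp add: distr_int_iterate)
qed

lemma integral_power_map:
  fixes f :: "'a \<Rightarrow> real"
  assumes "f \<in> borel_measurable M"
  shows "(LINT x|M. f (power_map m x)) = (LINT x|M. f x)"
  using integral_distr[OF measurable_power_map assms, of m] by (simp add: distr_power_map)

definition multi_avg_fun ::
    "(nat \<Rightarrow> int) \<Rightarrow> nat \<Rightarrow> (nat \<Rightarrow> 'a \<Rightarrow> 'b::real_normed_field) \<Rightarrow> nat \<Rightarrow> 'a \<Rightarrow> 'b" where
  "multi_avg_fun a k f N x =
     (1 / of_nat N) * (\<Sum>n=1..N. \<Prod>j=1..k. f j (power_map (a j * int n) x))"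

text \<open>
  Functions on countably many copies of the space, measurable on each copy. Pairing functions on the
  naturals make this algebra self-similar.
\<close>

definition layered :: "(nat \<times> 'a \<Rightarrow> real) set" where
  "layered = {f. (\<exists>C. \<forall>z. \<bar>f z\<bar> \<le> C) \<and> (\<forall>s. (\<lambda>x. f (s, x)) \<in> borel_measurable M)}"

lemma function_system_layered:
  "function_system layered (\<lambda>m z. (fst z, power_map m (snd z)))
     (\<lambda>n z. (prod_encode (n, fst z), snd z)) (\<lambda>z. fst (prod_decode (fst z)))
     (\<lambda>z. (snd (prod_decode (fst z)), snd z))"
proof
  fix f g assume fg: "f \<in> layered" "g \<in> layered"
  obtain C D where C: "\<And>z. \<bar>f z\<bar> \<le> C" and D: "\<And>z. \<bar>g z\<bar> \<le> D"
    using fg unfolding layered_def by blast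
  have "\<bar>f z + g z\<bar> \<le> C + D" "\<bar>f z * g z\<bar> \<le> C * D" for z
  proof -
    show "\<bar>f z + g z\<bar> \<le> C + D" using C[of z] D[of z] by linarith
    show "\<bar>f z * g z\<bar> \<le> C * D"
      unfolding abs_mult using C[of z] D[of z] by (intro mult_mono) auto
  qed
  moreover have "(\<lambda>x. f (s, x) + g (s, x)) \<in> borel_measurable M"
      "(\<lambda>x. f (s, x) * g (s, x)) \<in> borel_measurable M" for s
    using fg by (auto simp: layered_def intro: borel_measurable_add borel_measurable_times)
  ultimately show "(\<lambda>x. f x + g x) \<in> layered" "(\<lambda>x. f x * g x) \<in> layered"
    unfolding layered_def by blast+
next
  fix f and m :: int assume "f \<in> layered"
  then show "(\<lambda>z. f (fst z, power_map m (snd z))) \<in> layered"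
    by (auto simp: layered_def intro!: measurable_compose[OF measurable_power_map])
next
  fix h :: "nat \<Rightarrow> nat \<times> 'a \<Rightarrow> real" and C
  assume "\<And>n. h n \<in> layered" "\<And>n z. \<bar>h n z\<bar> \<le> C"
  then show "(\<lambda>z. h (fst (prod_decode (fst z))) (snd (prod_decode (fst z)), snd z)) \<in> layered"
    by (auto simp: layered_def intro!: exI[of _ C])
qed (auto simp: layered_def power_map_add int_iterate_def, auto simp: power_map_def int_iterate_def)

text \<open>
  The given system is embedded as copy number \<open>0\<close>, and all sequences are constant, so that the limits
  along the ultrafilter disappear.
\<close>

lemma real_multi_avg_L2_Cauchy:
  fixes f :: "nat \<Rightarrow> 'a \<Rightarrow> real"
  assumes f: "\<And>j. f j \<in> borel_measurable M" and C: "\<And>j x. \<bar>f j x\<bar> \<le> C" and \<epsilon>: "\<epsilon> > 0"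
  shows "\<exists>N\<^sub>0. \<forall>N\<ge>N\<^sub>0. \<forall>N'\<ge>N\<^sub>0.
    (LINT x|M. (multi_avg_fun a k f N x - multi_avg_fun a k f N' x)\<^sup>2) \<le> \<epsilon>"
proof -
  obtain U where U: "free_ultrafilter U" using free_ultrafilter_exists by blast
  interpret ultraproduct_system U layered "\<lambda>m z. (fst z, power_map m (snd z))"
     "\<lambda>n z. (prod_encode (n, fst z), snd z)" "\<lambda>z. fst (prod_decode (fst z))"
     "\<lambda>z. (snd (prod_decode (fst z)), snd z)" "\<lambda>j. a (Suc j)"
    by (intro ultraproduct_system.intro ultrafilter.intro U function_system_layered)
  define I where "I g = (LINT x|M. g (0, x))" for g :: "nat \<times> 'a \<Rightarrow> real"
  have int: "integrable M (\<lambda>x. g (0, x))" if g: "g \<in> layered" for g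
  proof -
    obtain c where "\<And>z. \<bar>g z\<bar> \<le> c" using g unfolding layered_def by blast
    then show ?thesis
      using g by (intro integrable_const_bound[where B = c]) (auto simp: layered_def)
  qed
  have I: "state I"
    unfolding state_def
  proof (intro conjI ballI allI impI)
    show "I (\<lambda>x. g x + h x) = I g + I h" if "g \<in> layered" "h \<in> layered" for g h
      using int that by (simp add: I_def)
    show "I (\<lambda>x. g (fst x, power_map n (snd x))) = I g" if "g \<in> layered" for g n
      using integral_power_map[of "\<lambda>x. g (0, x)"] that by (simp add: I_def layered_def)
  qed (auto simp: I_def prob_space)
  define F where "F j (i::nat) z = f (Suc j) (snd z)" for j i and z :: "nat \<times> 'a"
  have F: "bseq (F j)" for j
    using f C by (intro bseqI[where C = C]) (auto simp: F_def[abs_def] layered_def)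
  have avg: "multi_avg k (\<lambda>j. F j i) N (s, x) = multi_avg_fun a k f N x" for N i s x
    by (simp add: multi_avg_def multi_term_def avg_def F_def multi_avg_fun_def
        prod.atLeast1_atMost_eq)
  have "L2_Cauchy (\<lambda>_. I) (\<lambda>N i. multi_avg k (\<lambda>j. F j i) N)"
    using norm_convergence_all[of k, unfolded norm_convergence_def, rule_format, of "\<lambda>_. I" F] I F by simp
  then obtain N0 where "\<And>N N'. N \<ge> N0 \<Longrightarrow> N' \<ge> N0 \<Longrightarrow> lim_state (\<lambda>_. I) (\<lambda>i z.
      (multi_avg k (\<lambda>j. F j i) N z - multi_avg k (\<lambda>j. F j i) N' z)\<^sup>2) \<le> \<epsilon>"
    unfolding L2_Cauchy_def using \<epsilon> by blast
  then show ?thesis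
    by (intro exI[of _ N0]) (simp add: lim_state_def I_def avg ulim_eqI[OF tendsto_const])
qed

end

section \<open>Complex functions and completeness\<close>

lemma prod_Re_Im_expand:
  fixes z :: "nat \<Rightarrow> complex"
  assumes "finite A"
  shows "(\<Prod>j\<in>A. z j) =
    (\<Sum>X\<in>Pow A. \<i> ^ card (A - X) * complex_of_real (\<Prod>j\<in>A. if j \<in> X then Re (z j) else Im (z j)))"
proof -
  have "(\<Prod>j\<in>A. z j) = (\<Prod>j\<in>A. complex_of_real (Re (z j)) + \<i> * complex_of_real (Im (z j)))"
    by (simp add: complex_eq[symmetric])
  also have "\<dots> = (\<Sum>X\<in>Pow A. (\<Prod>j\<in>X. complex_of_real (Re (z j)))
      * (\<Prod>j\<in>A-X. \<i> * complex_of_real (Im (z j))))"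
    by (rule prod_add[OF assms])
  also have "\<dots> = (\<Sum>X\<in>Pow A. \<i> ^ card (A - X)
      * complex_of_real (\<Prod>j\<in>A. if j \<in> X then Re (z j) else Im (z j)))"
  proof (rule sum.cong[OF refl])
    fix X assume X: "X \<in> Pow A"
    have "(\<Prod>j\<in>A. if j \<in> X then Re (z j) else Im (z j)) = (\<Prod>j\<in>X. Re (z j)) * (\<Prod>j\<in>A-X. Im (z j))"
      using X assms by (subst prod.subset_diff[of X A]) (auto simp: mult.commute intro!: arg_cong2[where f = "(*)"] prod.cong)
    then show "(\<Prod>j\<in>X. complex_of_real (Re (z j))) * (\<Prod>j\<in>A-X. \<i> * complex_of_real (Im (z j)))
      = \<i> ^ card (A - X) * complex_of_real (\<Prod>j\<in>A. if j \<in> X then Re (z j) else Im (z j))"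
      by (simp add: prod.distrib)
  qed
  finally show ?thesis .
qed

context prob_space
begin

text \<open>
  A Cauchy sequence in \<open>L\<^sup>2\<close> is Cauchy in \<open>L\<^sup>1\<close>, so a subsequence converges almost everywhere. The
  uniform bound makes dominated convergence applicable to the distances from this subsequence.
\<close>

lemma bounded_L2_Cauchy_convergent:
  fixes g :: "nat \<Rightarrow> 'a \<Rightarrow> complex"
  assumes g [measurable]: "\<And>n. g n \<in> borel_measurable M" and C: "\<And>n x. norm (g n x) \<le> C"
    and cau: "\<And>\<epsilon>. \<epsilon> > 0 \<Longrightarrow> \<exists>N\<^sub>0. \<forall>n\<ge>N\<^sub>0. \<forall>m\<ge>N\<^sub>0. (LINT x|M. (norm (g n x - g m x))\<^sup>2) \<le> \<epsilon>"
  shows "\<exists>F. F \<in> borel_measurable M \<and> (AE x in M. norm (F x) \<le> C) \<and>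
    (\<lambda>n. LINT x|M. (norm (g n x - F x))\<^sup>2) \<longlonglongrightarrow> 0"
proof -
  have diff: "norm (g n x - g m x) \<le> 2 * C" for n m x
    using norm_triangle_ineq4[of "g n x" "g m x"] C[of n x] C[of m x] by linarith
  have diff2: "(norm (g n x - g m x))\<^sup>2 \<le> (2 * C)\<^sup>2" for n m x
    using diff by (intro power_mono) auto
  have int1: "integrable M (\<lambda>x. norm (g n x - g m x))" for n m
    by (rule integrable_const_bound[where B = "2 * C"]) (auto simp: diff)
  have int2: "integrable M (\<lambda>x. (norm (g n x - g m x))\<^sup>2)" for n m
  proof (rule integrable_const_bound[where B = "(2 * C)\<^sup>2"])
    show "AE x in M. norm ((norm (g n x - g m x))\<^sup>2) \<le> (2 * C)\<^sup>2"
      by (rule AE_I2) (simp only: real_norm_def abs_power2 diff2)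
  qed simp
  have "\<exists>N. \<forall>i\<ge>N. \<forall>j\<ge>N. (LINT x|M. norm (g i x - g j x)) < e" if e: "e > 0" for e :: real
  proof -
    define d where "d = e / 2"
    have d: "d > 0" using e by (simp add: d_def)
    obtain N where N: "\<And>n m. n \<ge> N \<Longrightarrow> m \<ge> N \<Longrightarrow> (LINT x|M. (norm (g n x - g m x))\<^sup>2) \<le> d\<^sup>2"
      using cau[of "d\<^sup>2"] d by auto
    have "(LINT x|M. norm (g i x - g j x)) < e" if "i \<ge> N" "j \<ge> N" for i j
    proof -
      \<comment> \<open>A substitute for the Cauchy--Schwarz inequality between the \<open>L\<^sup>1\<close> and \<open>L\<^sup>2\<close> norms.\<close>
      have "r \<le> d / 2 + (1 / (2 * d)) * r\<^sup>2" for r :: real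
      proof -
        have "2 * d * r \<le> d\<^sup>2 + r\<^sup>2" using sum_squares_bound[of d r] by simp
        then show ?thesis using d by (simp add: field_simps power2_eq_square)
      qed
      then have "(LINT x|M. norm (g i x - g j x))
          \<le> (LINT x|M. d / 2 + (1 / (2 * d)) * (norm (g i x - g j x))\<^sup>2)"
        by (intro integral_mono int1 Bochner_Integration.integrable_add integrable_const
            Bochner_Integration.integrable_mult_right int2)
      also have "\<dots> = d / 2 + (1 / (2 * d)) * (LINT x|M. (norm (g i x - g j x))\<^sup>2)"
        using int2 by (simp add: prob_space)
      also have "\<dots> \<le> d / 2 + (1 / (2 * d)) * d\<^sup>2"
        using d N[OF that] by (intro add_left_mono mult_left_mono) auto
      also have "\<dots> = d" using d by (simp add: power2_eq_square)
      also have "\<dots> < e" using e by (simp add: d_def)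
      finally show ?thesis .
    qed
    then show ?thesis by blast
  qed
  moreover have "integrable M (g n)" for n
    by (rule integrable_const_bound[where B = C]) (auto simp: C)
  ultimately obtain r where r: "strict_mono r" "AE x in M. Cauchy (\<lambda>i. g (r i) x)"
    using cauchy_L1_AE_cauchy_subseq[of M g] by blast
  define F where "F x = lim (\<lambda>i. g (r i) x)" for x
  have F [measurable]: "F \<in> borel_measurable M"
    unfolding F_def[abs_def] by (rule borel_measurable_lim_metric) simp
  have lim: "AE x in M. (\<lambda>i. g (r i) x) \<longlonglongrightarrow> F x"
    using r(2) by eventually_elim (simp add: F_def Cauchy_convergent_iff convergent_LIMSEQ_iff)
  have F_le: "AE x in M. norm (F x) \<le> C"
    using lim by eventually_elim (rule LIMSEQ_le_const2[OF tendsto_norm], auto simp: C)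
  have "(\<lambda>n. LINT x|M. (norm (g n x - F x))\<^sup>2) \<longlonglongrightarrow> 0"
  proof (rule LIMSEQ_I)
    fix e :: real assume e: "e > 0"
    obtain N where N: "\<And>n m. n \<ge> N \<Longrightarrow> m \<ge> N \<Longrightarrow> (LINT x|M. (norm (g n x - g m x))\<^sup>2) \<le> e / 2"
      using cau[of "e / 2"] e by auto
    have "norm ((LINT x|M. (norm (g n x - F x))\<^sup>2) - 0) < e" if n: "n \<ge> N" for n
    proof -
      have "(\<lambda>i. LINT x|M. (norm (g n x - g (r i) x))\<^sup>2) \<longlonglongrightarrow> (LINT x|M. (norm (g n x - F x))\<^sup>2)"
      proof (rule integral_dominated_convergence[where w = "\<lambda>_. (2 * C)\<^sup>2"])
        show "AE x in M. (\<lambda>i. (norm (g n x - g (r i) x))\<^sup>2) \<longlonglongrightarrow> (norm (g n x - F x))\<^sup>2"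
          using lim by eventually_elim (intro tendsto_intros)
        show "AE x in M. norm ((norm (g n x - g (r i) x))\<^sup>2) \<le> (2 * C)\<^sup>2" for i
          by (rule AE_I2) (simp only: real_norm_def abs_power2 diff2)
      qed simp_all
      moreover have "(LINT x|M. (norm (g n x - g (r i) x))\<^sup>2) \<le> e / 2" if "i \<ge> N" for i
        using N[OF n] that seq_suble[OF r(1), of i] by simp
      ultimately have "(LINT x|M. (norm (g n x - F x))\<^sup>2) \<le> e / 2"
        by (intro LIMSEQ_le_const2) auto
      moreover have "(LINT x|M. (norm (g n x - F x))\<^sup>2) \<ge> 0" by simp
      ultimately show ?thesis using e by simp
    qed
    then show "\<exists>N. \<forall>n\<ge>N. norm ((LINT x|M. (norm (g n x - F x))\<^sup>2) - 0) < e" by blast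
  qed
  then show ?thesis using F F_le by blast
qed

end

context measure_preserving_system
begin

lemma multi_avg_fun_measurable:
  fixes f :: "nat \<Rightarrow> 'a \<Rightarrow> 'b::{real_normed_field, second_countable_topology}"
  assumes "\<And>j. f j \<in> borel_measurable M"
  shows "multi_avg_fun a k f N \<in> borel_measurable M"
  unfolding multi_avg_fun_def[abs_def]
  by (intro borel_measurable_times borel_measurable_const borel_measurable_sum borel_measurable_prod
      measurable_compose[OF measurable_power_map] assms)

lemma multi_avg_fun_bounded:
  fixes f :: "nat \<Rightarrow> 'a \<Rightarrow> 'b::real_normed_field"
  assumes C: "\<And>j x. norm (f j x) \<le> C"
  shows "norm (multi_avg_fun a k f N x) \<le> C ^ k"
proof -
  have C0: "C \<ge> 0" using C[of 0 undefined] norm_ge_zero order_trans by blast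
  have "norm (\<Prod>j=1..k. f j (power_map (a j * int n) x)) \<le> C ^ k" for n
    unfolding prod_norm[symmetric]
    using prod_mono[of "{1..k}" "\<lambda>j. norm (f j (power_map (a j * int n) x))" "\<lambda>_. C"] C by simp
  then have "norm (\<Sum>n=1..N. \<Prod>j=1..k. f j (power_map (a j * int n) x)) \<le> of_nat (card {1..N}) * C ^ k"
    by (intro sum_norm_bound)
  then show ?thesis
    using C0 by (cases "N = 0") (simp_all add: multi_avg_fun_def norm_mult norm_divide divide_le_eq mult.commute)
qed

text \<open>
  The averages are multilinear, so complex functions reduce to the \<open>2\<^sup>k\<close> choices of a real or
  imaginary part for each factor.
\<close>

lemma multi_avg_fun_Re_Im:
  "multi_avg_fun a k f N x = (\<Sum>X\<in>Pow {1..k}. \<i> ^ card ({1..k} - X)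
     * complex_of_real (multi_avg_fun a k (\<lambda>j y. if j \<in> X then Re (f j y) else Im (f j y)) N x))"
  unfolding multi_avg_fun_def prod_Re_Im_expand[OF finite_atLeastAtMost]
  by (subst sum.swap) (simp add: sum_distrib_left mult_ac)

lemma complex_multi_avg_L2_Cauchy:
  fixes f :: "nat \<Rightarrow> 'a \<Rightarrow> complex"
  assumes f: "\<And>j. f j \<in> borel_measurable M" and C: "\<And>j x. norm (f j x) \<le> C" and \<epsilon>: "\<epsilon> > 0"
  shows "\<exists>N\<^sub>0. \<forall>N\<ge>N\<^sub>0. \<forall>N'\<ge>N\<^sub>0.
    (LINT x|M. (norm (multi_avg_fun a k f N x - multi_avg_fun a k f N' x))\<^sup>2) \<le> \<epsilon>"
proof -
  define P where "P = Pow {1..k}"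
  have P: "finite P" "card P > 0" by (auto simp: P_def card_gt_0_iff)
  define h where "h X j y = (if j \<in> X then Re (f j y) else Im (f j y))" for X j y
  have h: "h X j \<in> borel_measurable M" for X j
    using f[of j] by (cases "j \<in> X") (simp_all add: h_def[abs_def])
  have h_le: "\<bar>h X j x\<bar> \<le> C" for X j x
    using abs_Re_le_cmod[of "f j x"] abs_Im_le_cmod[of "f j x"] C[of j x] by (auto simp: h_def)
  define \<delta> where "\<delta> = \<epsilon> / (real (card P))\<^sup>2"
  have \<delta>: "\<delta> > 0" unfolding \<delta>_def using \<epsilon> P by (intro divide_pos_pos) auto
  define d where "d N N' X x = multi_avg_fun a k (h X) N x - multi_avg_fun a k (h X) N' x" for N N' X x
  have "\<exists>N0. \<forall>N\<ge>N0. \<forall>N'\<ge>N0. (LINT x|M. (d N N' X x)\<^sup>2) \<le> \<delta>" for X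
    unfolding d_def by (rule real_multi_avg_L2_Cauchy[OF h h_le \<delta>])
  then obtain N0 where N0: "\<And>X N N'. N \<ge> N0 X \<Longrightarrow> N' \<ge> N0 X \<Longrightarrow> (LINT x|M. (d N N' X x)\<^sup>2) \<le> \<delta>"
    by metis
  have d_meas: "d N N' X \<in> borel_measurable M" for N N' X
    unfolding d_def[abs_def] by (intro borel_measurable_diff multi_avg_fun_measurable h)
  have d_int: "integrable M (\<lambda>x. (d N N' X x)\<^sup>2)" for N N' X
  proof (rule integrable_const_bound[where B = "(2 * C ^ k)\<^sup>2"])
    have "\<bar>d N N' X x\<bar> \<le> 2 * C ^ k" for x
      using multi_avg_fun_bounded[of "h X" C a k N x] multi_avg_fun_bounded[of "h X" C a k N' x] h_le
      by (simp add: d_def)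
    then have "(d N N' X x)\<^sup>2 \<le> (2 * C ^ k)\<^sup>2" for x
      by (metis abs_ge_zero power2_abs power_mono)
    then show "AE x in M. norm ((d N N' X x)\<^sup>2) \<le> (2 * C ^ k)\<^sup>2" by simp
  qed (use d_meas in simp)
  have pointwise: "(norm (multi_avg_fun a k f N x - multi_avg_fun a k f N' x))\<^sup>2
      \<le> real (card P) * (\<Sum>X\<in>P. (d N N' X x)\<^sup>2)" for N N' x
  proof -
    have "multi_avg_fun a k f N x - multi_avg_fun a k f N' x
        = (\<Sum>X\<in>P. \<i> ^ card ({1..k} - X) * complex_of_real (d N N' X x))"
      unfolding multi_avg_fun_Re_Im[of a k f N] multi_avg_fun_Re_Im[of a k f N'] sum_subtractf[symmetric]
      by (simp add: P_def d_def h_def[abs_def] right_diff_distrib)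
    also have "norm \<dots> \<le> (\<Sum>X\<in>P. \<bar>d N N' X x\<bar>)"
      by (rule order_trans[OF norm_sum]) (simp add: norm_mult norm_power)
    finally have "(norm (multi_avg_fun a k f N x - multi_avg_fun a k f N' x))\<^sup>2 \<le> (\<Sum>X\<in>P. \<bar>d N N' X x\<bar>)\<^sup>2"
      by (intro power_mono) auto
    also have "\<dots> \<le> real (card P) * (\<Sum>X\<in>P. (d N N' X x)\<^sup>2)"
      using sum_squared_le_sum_of_squares[of "\<lambda>X. \<bar>d N N' X x\<bar>" P] by (simp add: mult.commute)
    finally show ?thesis .
  qed
  have "(LINT x|M. (norm (multi_avg_fun a k f N x - multi_avg_fun a k f N' x))\<^sup>2) \<le> \<epsilon>"
    if N: "N \<ge> Max (N0 ` P)" "N' \<ge> Max (N0 ` P)" for N N'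
  proof -
    have N0_le: "N0 X \<le> N" "N0 X \<le> N'" if "X \<in> P" for X
      using Max_ge[OF finite_imageI[OF P(1)] imageI[OF that], of N0] N by (blast intro: order_trans)+
    have "(LINT x|M. (norm (multi_avg_fun a k f N x - multi_avg_fun a k f N' x))\<^sup>2)
        \<le> (LINT x|M. real (card P) * (\<Sum>X\<in>P. (d N N' X x)\<^sup>2))"
      by (intro integral_mono' Bochner_Integration.integrable_mult_right
          Bochner_Integration.integrable_sum d_int pointwise) (simp add: sum_nonneg)
    also have "\<dots> = real (card P) * (\<Sum>X\<in>P. LINT x|M. (d N N' X x)\<^sup>2)"
      using d_int by simp
    also have "\<dots> \<le> real (card P) * (\<Sum>X\<in>P. \<delta>)"
      by (intro mult_left_mono sum_mono N0 N0_le) auto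
    also have "\<dots> = \<epsilon>" using P by (auto simp: \<delta>_def power2_eq_square card_gt_0_iff)
    finally show ?thesis .
  qed
  then show ?thesis by blast
qed

lemma L_infinity_truncation:
  assumes "f \<in> L_infinity M"
  obtains g C where "g \<in> borel_measurable M" "\<And>x. norm (g x) \<le> C" "C \<ge> 0" "AE x in M. f x = g x"
proof -
  have [measurable]: "f \<in> borel_measurable M" using assms by (simp add: L_infinity_def)
  obtain n :: nat where n: "esssup M (\<lambda>x. ereal (norm (f x))) < ereal (real n)"
    using assms less_PInf_Ex_of_nat by (auto simp: L_infinity_def)
  define g where "g x = (if norm (f x) \<le> real n then f x else 0)" for x
  have "g \<in> borel_measurable M" unfolding g_def[abs_def] by measurable
  moreover have "AE x in M. f x = g x"
    using esssup_AE[of "\<lambda>x. ereal (norm (f x))" M]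
  proof eventually_elim
    case (elim x)
    then have "ereal (norm (f x)) < ereal (real n)" using n by (rule order_le_less_trans)
    then show ?case by (simp add: g_def)
  qed
  ultimately show ?thesis by (intro that[of g "real n"]) (auto simp: g_def)
qed

lemma AE_power_map:
  assumes "AE x in M. P x" shows "AE x in M. P (power_map m x)"
  by (rule AE_distrD[OF measurable_power_map]) (simp only: distr_power_map assms)

theorem multiple_averages_converge:
  fixes f :: "nat \<Rightarrow> 'a \<Rightarrow> complex"
  assumes f: "\<And>j. j \<in> {1..k} \<Longrightarrow> f j \<in> L_infinity M"
  shows "converges_in_L2 M
    (\<lambda>N x. (1 / of_nat N) * (\<Sum>n=1..N. \<Prod>j=1..k. f j (int_iterate M T (a j * int n) x)))"
    (is "converges_in_L2 M ?A")
proof -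
  have "\<exists>g C. g \<in> borel_measurable M \<and> (\<forall>x. norm (g x) \<le> C) \<and> C \<ge> 0 \<and>
      (j \<in> {1..k} \<longrightarrow> (AE x in M. f j x = g x))" for j
  proof (cases "j \<in> {1..k}")
    case True
    then show ?thesis using L_infinity_truncation[OF f[OF True]] by metis
  next
    case False
    then show ?thesis by (intro exI[of _ "\<lambda>_. 0"] exI[of _ 0]) auto
  qed
  then obtain g0 C0 where g0: "\<And>j. g0 j \<in> borel_measurable M" "\<And>j x. norm (g0 j x) \<le> C0 j" "\<And>j. C0 j \<ge> 0"
      "\<And>j. j \<in> {1..k} \<Longrightarrow> AE x in M. f j x = g0 j x"
    by metis
  define g where "g j = (if j \<in> {1..k} then g0 j else (\<lambda>_. 0))" for j
  define C where "C = (\<Sum>j=1..k. C0 j)"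
  have g: "g j \<in> borel_measurable M" for j by (simp add: g_def g0)
  have "C0 j \<le> C" if "j \<in> {1..k}" for j
    unfolding C_def by (rule member_le_sum) (use that g0 in auto)
  moreover have "C \<ge> 0" unfolding C_def by (intro sum_nonneg g0)
  ultimately have C: "norm (g j x) \<le> C" for j x
    unfolding g_def using g0(2)[of j x] by (auto intro: order_trans)
  have f_meas: "f j \<in> borel_measurable M" if "j \<in> {1..k}" for j
    using f[OF that] by (simp add: L_infinity_def)
  define G where "G = multi_avg_fun a k g"
  have G: "G N \<in> borel_measurable M" "norm (G N x) \<le> C ^ k" for N x
    unfolding G_def by (intro multi_avg_fun_measurable g) (rule multi_avg_fun_bounded[OF C])
  have G_Cauchy: "\<exists>N\<^sub>0. \<forall>N\<ge>N\<^sub>0. \<forall>N'\<ge>N\<^sub>0. (LINT x|M. (norm (G N x - G N' x))\<^sup>2) \<le> \<epsilon>"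
    if "\<epsilon> > 0" for \<epsilon>
    unfolding G_def by (rule complex_multi_avg_L2_Cauchy[OF g C that])
  obtain F where F: "F \<in> borel_measurable M" "AE x in M. norm (F x) \<le> C ^ k"
      "(\<lambda>N. LINT x|M. (norm (G N x - F x))\<^sup>2) \<longlonglongrightarrow> 0"
    using bounded_L2_Cauchy_convergent[OF G G_Cauchy] by blast
  have "AE x in M. \<forall>n. \<forall>j\<in>{1..k}. f j (power_map (a j * int n) x) = g j (power_map (a j * int n) x)"
    unfolding AE_all_countable
  proof
    fix n
    have "AE x in M. f j (power_map (a j * int n) x) = g j (power_map (a j * int n) x)" if "j \<in> {1..k}" for j
      using AE_power_map[OF g0(4)[OF that]] that by (simp add: g_def)
    then show "AE x in M. \<forall>j\<in>{1..k}. f j (power_map (a j * int n) x) = g j (power_map (a j * int n) x)"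
      by (intro AE_finite_allI) auto
  qed
  then have AE_eq: "AE x in M. \<forall>N. ?A N x = G N x"
    using AE_space
  proof eventually_elim
    case (elim x)
    then show ?case
      unfolding G_def multi_avg_fun_def
      by (intro allI arg_cong2[where f = "(*)"] sum.cong prod.cong refl) (simp add: power_map_def)
  qed
  have A_meas: "?A N \<in> borel_measurable M" for N
    by (intro borel_measurable_times borel_measurable_const borel_measurable_sum borel_measurable_prod
        measurable_compose[OF measurable_int_iterate] f_meas)
  have L2: "h \<in> L2_space M" if h: "h \<in> borel_measurable M" "AE x in M. norm (h x) \<le> D" for h :: "'a \<Rightarrow> complex" and D
  proof -
    have "AE x in M. norm ((norm (h x))\<^sup>2) \<le> D\<^sup>2"
      using h(2) by eventually_elim (simp add: power_mono)
    then have "integrable M (\<lambda>x. (norm (h x))\<^sup>2)"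
      using h(1) by (intro integrable_const_bound[where B = "D\<^sup>2"]) auto
    then show ?thesis using h by (simp add: L2_space_def)
  qed
  have "?A N \<in> L2_space M" for N
  proof (rule L2[OF A_meas])
    show "AE x in M. norm (?A N x) \<le> C ^ k"
      using AE_eq by eventually_elim (simp only: G(2))
  qed
  moreover have "F \<in> L2_space M" by (rule L2[OF F(1,2)])
  moreover have "(\<lambda>N. L2_norm M (\<lambda>x. ?A N x - F x)) \<longlonglongrightarrow> 0"
  proof -
    have "(LINT x|M. (norm (?A N x - F x))\<^sup>2) = (LINT x|M. (norm (G N x - F x))\<^sup>2)" for N
    proof (rule integral_cong_AE)
      show "AE x in M. (norm (?A N x - F x))\<^sup>2 = (norm (G N x - F x))\<^sup>2"
        using AE_eq by eventually_elim (simp only:)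
      show "(\<lambda>x. (norm (?A N x - F x))\<^sup>2) \<in> borel_measurable M"
        by (intro borel_measurable_power measurable_compose[OF borel_measurable_diff[OF A_meas F(1)] borel_measurable_norm])
      show "(\<lambda>x. (norm (G N x - F x))\<^sup>2) \<in> borel_measurable M"
        by (intro borel_measurable_power measurable_compose[OF borel_measurable_diff[OF G(1) F(1)] borel_measurable_norm])
    qed
    then have "(\<lambda>N. L2_norm M (\<lambda>x. ?A N x - F x)) = (\<lambda>N. sqrt (LINT x|M. (norm (G N x - F x))\<^sup>2))"
      unfolding L2_norm_def by simp
    then show ?thesis using tendsto_real_sqrt[OF F(3)] by simp
  qed
  ultimately show ?thesis unfolding converges_in_L2_def by blast
qed

end

theorem corollary1p8:
  fixes M :: "'a measure" and T :: "'a \<Rightarrow> 'a"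
    and k :: nat and a :: "nat \<Rightarrow> int" and f :: "nat \<Rightarrow> 'a \<Rightarrow> complex"
  assumes "measure_preserving_system M T"
    and "\<And>j. j \<in> {1..k} \<Longrightarrow> f j \<in> L_infinity M"
  shows "converges_in_L2 M
    (\<lambda>N x. (1 / of_nat N) * (\<Sum>n=1..N. \<Prod>j=1..k. f j (int_iterate M T (a j * int n) x)))"
  using measure_preserving_system.multiple_averages_converge[OF assms] .

end
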